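(* If the max-variant of the matching problem for the subsequence relation, or the min-variant of the matching problem for the supersequence relation, can be solved in time $O((|w|m)^{1-\epsilon})$ for some $\epsilon>0$, then the Strong Exponential Time Hypothesis (SETH) fails. This holds even if only the length of the answer string is required.
   Context: Input: a string $w\in\Sigma^*$ and an $\varepsilon$NFA $A=(Q,\Sigma,q_0,q_f,\delta)$, $\delta\subseteq Q\times(\Sigma\cup\{\varepsilon\})\times Q$, with $m=|\delta|$ transitions; $\mathcal{L}(A)$ is the set of strings labelling (ignoring $\varepsilon$) a path from $q_0$ to $q_f$. $u$ is a subsequence of $w$ if $u=w[j_1]\cdots w[j_{|u|}]$ for some $1\le j_1<\dots<j_{|u|}\le|w|$; $u$ is a supersequence of $w$ if $w$ is a subsequence of $u$. Max-variant of subsequence matching: report that subsequences of $w$ in $\mathcal{L}(A)$ are unbounded in length, or compute a longest subsequence of $w$ in $\mathcal{L}(A)$, or report none exists. Min-variant of supersequence matching: compute a shortest supersequence of $w$ in $\mathcal{L}(A)$, or report none exists. *)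

theory Defs
  imports Complex_Main "HOL-Library.Sublist"
begin

section \<open>Computation model: word RAM\<close>

text \<open>
  Structured word-RAM programs with finitely many registers and finitely many random-access
  arrays (the ones named in the program). Every instruction and every test costs one time unit.
  Subtraction is truncated, so comparisons are available through \<open>Minus\<close>.
\<close>

datatype binop = Plus | Minus | Times | Divide | And | Or | Xor | ShiftL | ShiftR

fun apply_op :: "binop \<Rightarrow> nat \<Rightarrow> nat \<Rightarrow> nat" where
  "apply_op Plus a b = a + b"
| "apply_op Minus a b = a - b"
| "apply_op Times a b = a * b"
| "apply_op Divide a b = a div b"
| "apply_op And a b = Bit_Operations.and a b"
| "apply_op Or a b = Bit_Operations.or a b"
| "apply_op Xor a b = Bit_Operations.xor a b"
| "apply_op ShiftL a b = push_bit b a"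
| "apply_op ShiftR a b = drop_bit b a"

type_synonym reg = nat
type_synonym arr = nat

datatype com =
    Skip
  | Const reg nat
  | Op binop reg reg reg
  | Load reg arr reg
  | Store arr reg reg
  | Seq com com
  | IfNZ reg com com
  | WhileNZ reg com

type_synonym state = "(reg \<Rightarrow> nat) \<times> (arr \<Rightarrow> nat \<Rightarrow> nat)"

text \<open>
  \<open>exec W c s t s'\<close>: started in \<open>s\<close>, program \<open>c\<close> halts in \<open>s'\<close> after \<open>t\<close> steps, all values
  written being smaller than \<open>W\<close>. An instruction whose result does not fit into a word has no
  successor state. Since registers start at zero, the array addresses used are below \<open>W\<close> as well.
\<close>

inductive exec :: "nat \<Rightarrow> com \<Rightarrow> state \<Rightarrow> nat \<Rightarrow> state \<Rightarrow> bool" for W :: nat where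
  exec_Skip: "exec W Skip s 1 s"
| exec_Const: "n < W \<Longrightarrow> exec W (Const x n) (r, M) 1 (r(x := n), M)"
| exec_Op: "apply_op f (r y) (r z) < W \<Longrightarrow>
    exec W (Op f x y z) (r, M) 1 (r(x := apply_op f (r y) (r z)), M)"
| exec_Load: "M a (r y) < W \<Longrightarrow> exec W (Load x a y) (r, M) 1 (r(x := M a (r y)), M)"
| exec_Store: "exec W (Store a y z) (r, M) 1 (r, M(a := (M a)(r y := r z)))"
| exec_Seq: "exec W c1 s1 t1 s2 \<Longrightarrow> exec W c2 s2 t2 s3 \<Longrightarrow> exec W (Seq c1 c2) s1 (t1 + t2) s3"
| exec_If_nonzero: "fst s x \<noteq> 0 \<Longrightarrow> exec W c1 s t s' \<Longrightarrow> exec W (IfNZ x c1 c2) s (1 + t) s'"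
| exec_If_zero: "fst s x = 0 \<Longrightarrow> exec W c2 s t s' \<Longrightarrow> exec W (IfNZ x c1 c2) s (1 + t) s'"
| exec_While_zero: "fst s x = 0 \<Longrightarrow> exec W (WhileNZ x c) s 1 s"
| exec_While_nonzero: "fst s1 x \<noteq> 0 \<Longrightarrow> exec W c s1 t1 s2 \<Longrightarrow> exec W (WhileNZ x c) s2 t2 s3 \<Longrightarrow>
    exec W (WhileNZ x c) s1 (1 + t1 + t2) s3"

text \<open>The input is placed in array 0; the output is read off array 1 (output formats below are
  self-delimiting).\<close>

definition init_state :: "nat list \<Rightarrow> state" where
  "init_state xs = ((\<lambda>_. 0), (\<lambda>a i. if a = 0 \<and> i < length xs then xs ! i else 0))"

definition outputs :: "state \<Rightarrow> nat list \<Rightarrow> bool" where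
  "outputs s ys \<longleftrightarrow> (\<forall>i < length ys. snd s 1 i = ys ! i)"

text \<open>
  A problem is given by the relation \<open>enc\<close> between instances and their encodings and the relation
  \<open>ans\<close> between instances and acceptable outputs. \<open>solvable_in_time enc ans T\<close>: some
  program is correct on every encoding of every instance \<open>x\<close> and runs in time \<open>O(T x)\<close> on words of
  \<open>O(log (T x))\<close> bits, as needed to address \<open>T x\<close> memory cells. (For time bounds between the
  input size and a polynomial in it, this is the usual logarithmic word size.)
\<close>

definition solvable_in_time ::
    "('i \<Rightarrow> nat list \<Rightarrow> bool) \<Rightarrow> ('i \<Rightarrow> nat list \<Rightarrow> bool) \<Rightarrow> ('i \<Rightarrow> real) \<Rightarrow> bool" where
  "solvable_in_time enc ans T \<longleftrightarrow>
     (\<exists>(P :: com) (C :: real) (K :: nat). \<forall>x xs. enc x xs \<longrightarrow>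
        (\<exists>W t s ys. real W \<le> (real K + T x) ^ K \<and> real t \<le> C * T x \<and>
           exec W P (init_state xs) t s \<and> outputs s ys \<and> ans x ys))"


section \<open>The Strong Exponential Time Hypothesis\<close>

text \<open>A literal \<open>(v, b)\<close> is variable \<open>v\<close> if \<open>b\<close>, its negation otherwise. A formula is a pair of
  the number \<open>n\<close> of variables (which are \<open>0, ..., n - 1\<close>) and a set of clauses.\<close>

type_synonym literal = "nat \<times> bool"
type_synonym clause = "literal set"
type_synonym cnf = "nat \<times> clause set"

definition is_kcnf :: "nat \<Rightarrow> cnf \<Rightarrow> bool" where
  "is_kcnf k = (\<lambda>(n, F). \<forall>c \<in> F. finite c \<and> card c \<le> k \<and> fst ` c \<subseteq> {..<n})"

definition satisfiable :: "cnf \<Rightarrow> bool" where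
  "satisfiable = (\<lambda>(n, F). \<exists>\<alpha> :: nat \<Rightarrow> bool. \<forall>c \<in> F. \<exists>(v, b) \<in> c. \<alpha> v = b)"

definition enc_literal :: "literal \<Rightarrow> nat" where
  "enc_literal = (\<lambda>(v, b). 2 * v + of_bool b)"

text \<open>No clause and no literal within a clause is listed twice. Hence the encoding of a \<open>k\<close>-CNF
  formula has length polynomial in \<open>n\<close> for fixed \<open>k\<close>, and it makes sense to measure time in \<open>n\<close> only.\<close>

definition ksat_enc :: "nat \<Rightarrow> cnf \<Rightarrow> nat list \<Rightarrow> bool" where
  "ksat_enc k = (\<lambda>(n, F) xs. is_kcnf k (n, F) \<and>
     (\<exists>css :: literal list list. F = set (map set css) \<and> distinct (map set css) \<and>
        (\<forall>cs \<in> set css. distinct cs) \<and>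
        xs = [n, length css] @ concat (map (\<lambda>cs. length cs # map enc_literal cs) css)))"

definition sat_answer :: "cnf \<Rightarrow> nat list \<Rightarrow> bool" where
  "sat_answer \<phi> ys \<longleftrightarrow> ys = [of_bool (satisfiable \<phi>)]"

definition SETH :: bool where
  "SETH \<longleftrightarrow> (\<forall>\<epsilon>::real. \<epsilon> > 0 \<longrightarrow> (\<exists>k \<ge> 3.
     \<not> solvable_in_time (ksat_enc k) sat_answer (\<lambda>(n, F). 2 powr ((1 - \<epsilon>) * real n))))"


section \<open>Automata with epsilon-transitions\<close>

text \<open>The label \<open>None\<close> stands for the empty word.\<close>

record ('q, 'a) enfa =
  states :: "'q set"
  alphabet :: "'a set"
  start :: 'q
  final :: 'q
  trans :: "('q \<times> 'a option \<times> 'q) set"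

definition wf_enfa :: "('q, 'a) enfa \<Rightarrow> bool" where
  "wf_enfa A \<longleftrightarrow> finite (states A) \<and> finite (alphabet A) \<and>
     start A \<in> states A \<and> final A \<in> states A \<and>
     trans A \<subseteq> states A \<times> insert None (Some ` alphabet A) \<times> states A"

inductive path :: "('q \<times> 'a option \<times> 'q) set \<Rightarrow> 'q \<Rightarrow> 'a list \<Rightarrow> 'q \<Rightarrow> bool"
  for \<delta> :: "('q \<times> 'a option \<times> 'q) set" where
  path_refl: "path \<delta> p [] p"
| path_eps: "(p, None, r) \<in> \<delta> \<Longrightarrow> path \<delta> r u q \<Longrightarrow> path \<delta> p u q"
| path_sym: "(p, Some a, r) \<in> \<delta> \<Longrightarrow> path \<delta> r u q \<Longrightarrow> path \<delta> p (a # u) q"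

definition lang :: "('q, 'a) enfa \<Rightarrow> 'a list set" where
  "lang A = {u. path (trans A) (start A) u (final A)}"


section \<open>The matching problems\<close>

type_synonym match_instance = "nat list \<times> (nat, nat) enfa"

fun enc_trans :: "nat \<times> nat option \<times> nat \<Rightarrow> nat list" where
  "enc_trans (p, None, q) = [p, 0, q]"
| "enc_trans (p, Some a, q) = [p, Suc a, q]"

text \<open>States and letters are consecutive integers (integer alphabet); the transitions are listed
  in any order, each of them once.\<close>

definition match_enc :: "match_instance \<Rightarrow> nat list \<Rightarrow> bool" where
  "match_enc = (\<lambda>(w, A) xs. wf_enfa A \<and> w \<in> lists (alphabet A) \<and>
     states A = {..<card (states A)} \<and> alphabet A = {..<card (alphabet A)} \<and>
     (\<exists>ts. distinct ts \<and> set ts = trans A \<and>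
        xs = [length w, length ts, card (states A), card (alphabet A), start A, final A]
             @ w @ concat (map enc_trans ts)))"

datatype 'a answer = NoString | Unbounded | Found "'a list"

fun max_answer :: "'a list set \<Rightarrow> 'a answer \<Rightarrow> bool" where
  "max_answer S NoString \<longleftrightarrow> S = {}"
| "max_answer S Unbounded \<longleftrightarrow> (\<forall>n. \<exists>u \<in> S. length u > n)"
| "max_answer S (Found u) \<longleftrightarrow> u \<in> S \<and> (\<forall>v \<in> S. length v \<le> length u)"

fun min_answer :: "'a list set \<Rightarrow> 'a answer \<Rightarrow> bool" where
  "min_answer S NoString \<longleftrightarrow> S = {}"
| "min_answer S Unbounded \<longleftrightarrow> False"
| "min_answer S (Found u) \<longleftrightarrow> u \<in> S \<and> (\<forall>v \<in> S. length u \<le> length v)"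

text \<open>Output formats: the answer string itself, or only its length.\<close>

fun out_string :: "nat answer \<Rightarrow> nat list" where
  "out_string NoString = [0]"
| "out_string Unbounded = [1]"
| "out_string (Found u) = 2 # length u # u"

fun out_length :: "nat answer \<Rightarrow> nat list" where
  "out_length NoString = [0]"
| "out_length Unbounded = [1]"
| "out_length (Found u) = [2, length u]"

definition max_subseq :: "(nat answer \<Rightarrow> nat list) \<Rightarrow> match_instance \<Rightarrow> nat list \<Rightarrow> bool" where
  "max_subseq out = (\<lambda>(w, A) ys. \<exists>a. max_answer {u \<in> lang A. subseq u w} a \<and> ys = out a)"

definition min_superseq :: "(nat answer \<Rightarrow> nat list) \<Rightarrow> match_instance \<Rightarrow> nat list \<Rightarrow> bool" where
  "min_superseq out = (\<lambda>(w, A) ys. \<exists>a. min_answer {u \<in> lang A. subseq w u} a \<and> ys = out a)"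

text \<open>
  The bound \<open>(|w| m) powr (1 - \<epsilon>)\<close>, plus time linear in the input size. Without the latter term no
  algorithm could meet the bound on, say, instances with \<open>|w| = 1\<close>, where the bound is sublinear
  in the number \<open>m\<close> of transitions. As the term only enlarges the allowed time, a lower bound for
  the time below is also one for \<open>(|w| m) powr (1 - \<epsilon>)\<close> alone.
\<close>

definition input_size :: "match_instance \<Rightarrow> nat" where
  "input_size = (\<lambda>(w, A). length w + card (trans A) + card (states A) + card (alphabet A))"

definition match_time :: "real \<Rightarrow> match_instance \<Rightarrow> real" where
  "match_time \<epsilon> = (\<lambda>(w, A).
     real (input_size (w, A)) + (real (length w) * real (card (trans A))) powr (1 - \<epsilon>))"

end

theory Submission
  imports Defs
begin

text \<open>
  Split the \<open>n\<close> variables of a \<open>k\<close>-CNF formula into two halves. A word lists, for each assignment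
  \<open>b\<close> of the first half, a block of bits saying which clauses \<open>b\<close> leaves unsatisfied; an automaton
  guesses an assignment \<open>a\<close> of the second half and a block, and checks that \<open>a\<close> satisfies the clauses
  marked in it. Word and automaton both have size \<open>2 powr (n / 2)\<close> times the number of clauses, which
  is polynomial in \<open>n\<close>, so that time \<open>(|w| m) powr (1 - \<epsilon>)\<close> for deciding whether the automaton
  accepts the word \<open>w\<close> refutes SETH. The matching problems decide this, as \<open>w\<close> is the only
  subsequence, and the only supersequence, of \<open>w\<close> of length \<open>|w|\<close>.
\<close>

text \<open>Two obstacles shape the development. The reduction must be an explicit word-RAM program
  around a solver of which nothing is known but its correctness, running time and word size. So the
  solver is renamed into registers and arrays that the reduction leaves alone, and every entry of
  the instance is a loop-free expression in its index: word and transition list are then filled by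
  one loop each, and a single static cost bounds both time and word size. The second obstacle is the
  exponent. For \<open>M\<close> clauses, \<open>|w| m\<close> is \<open>2 ^ n * (M + 1) ^ 2\<close>
  up to a constant factor. The saving is first capped to \<open>e = min \<epsilon> (1 / 2)\<close>,
  so that the linear part of the time, about \<open>2 powr (n / 2)\<close> times the number of
  clauses, also fits. As no clause is listed twice, \<open>M \<le> (2 * n + 1) ^ k\<close>, and half
  of the saving, \<open>2 powr (e / 2 * n)\<close>, absorbs \<open>(M + 1) ^ 2\<close>. The
  remaining saving \<open>e / 2\<close> is the same for all \<open>k\<close>, as the negation of
  SETH demands.\<close>

section \<open>Programs\<close>

text \<open>The rules of \<open>exec\<close> mention the literal 1, which \<open>simp\<close> would turn into \<open>Suc 0\<close>.\<close>

declare One_nat_def [simp del]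

lemma exec_mono: "exec W c s t s' \<Longrightarrow> W \<le> W' \<Longrightarrow> exec W' c s t s'"
  by (induction rule: exec.induct) (auto intro: exec.intros)

text \<open>\<open>Store\<close> is not checked against \<open>W\<close>, but it copies a register,
  and every register write is checked. Later this bounds the solver's output array, about which
  correctness says nothing beyond the answer itself.\<close>

lemma exec_bounded:
  assumes "exec W c s t s'" "\<forall>x. fst s x < W" "\<forall>i. snd s a i < W"
  shows "(\<forall>x. fst s' x < W) \<and> (\<forall>i. snd s' a i < W)"
  using assms by (induction rule: exec.induct) auto

text \<open>A solver obtained from a solvability hypothesis may touch any register and any array;
  injective renaming keeps it apart from the program around it.\<close>

fun rename :: "(reg \<Rightarrow> reg) \<Rightarrow> (arr \<Rightarrow> arr) \<Rightarrow> com \<Rightarrow> com" where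
  "rename f g Skip = Skip"
| "rename f g (Const x n) = Const (f x) n"
| "rename f g (Op p x y z) = Op p (f x) (f y) (f z)"
| "rename f g (Load x a y) = Load (f x) (g a) (f y)"
| "rename f g (Store a y z) = Store (g a) (f y) (f z)"
| "rename f g (Seq c d) = Seq (rename f g c) (rename f g d)"
| "rename f g (IfNZ x c d) = IfNZ (f x) (rename f g c) (rename f g d)"
| "rename f g (WhileNZ x c) = WhileNZ (f x) (rename f g c)"

definition pull :: "(reg \<Rightarrow> reg) \<Rightarrow> (arr \<Rightarrow> arr) \<Rightarrow> state \<Rightarrow> state" where
  "pull f g S = (fst S \<circ> f, snd S \<circ> g)"

definition same_outside :: "(reg \<Rightarrow> reg) \<Rightarrow> (arr \<Rightarrow> arr) \<Rightarrow> state \<Rightarrow> state \<Rightarrow> bool" where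
  "same_outside f g S S' \<longleftrightarrow>
     (\<forall>x. x \<notin> range f \<longrightarrow> fst S' x = fst S x) \<and> (\<forall>a. a \<notin> range g \<longrightarrow> snd S' a = snd S a)"

text \<open>Injectivity makes an update at \<open>f x\<close> or \<open>g a\<close> invisible at all
  other renamed places, so pulling back commutes with every instruction. \<open>same_outside\<close>
  protects the data of the surrounding program.\<close>

lemma exec_rename:
  assumes "exec W c s t s'" "inj f" "inj g" "pull f g S = s"
  shows "\<exists>S'. exec W (rename f g c) S t S' \<and> pull f g S' = s' \<and> same_outside f g S S'"
  using assms
proof (induction arbitrary: S rule: exec.induct)
  case (exec_Skip s)
  then show ?case by (intro exI[of _ S]) (auto simp: same_outside_def intro: exec.intros)
next
  case (exec_Const n x r M)
  then show ?case
    by (intro exI[of _ "((fst S)(f x := n), snd S)"])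
       (cases S; auto simp: same_outside_def pull_def inj_eq intro!: exec.intros ext)
next
  case (exec_Op p r y z x M)
  then have "apply_op p (fst S (f y)) (fst S (f z)) < W" by (auto simp: pull_def)
  with exec_Op show ?case
    by (intro exI[of _ "((fst S)(f x := apply_op p (fst S (f y)) (fst S (f z))), snd S)"])
       (cases S; auto simp: same_outside_def pull_def inj_eq intro!: exec.intros ext)
next
  case (exec_Load M a r y x)
  then have "snd S (g a) (fst S (f y)) < W" by (auto simp: pull_def)
  with exec_Load show ?case
    by (intro exI[of _ "((fst S)(f x := snd S (g a) (fst S (f y))), snd S)"])
       (cases S; auto simp: same_outside_def pull_def inj_eq intro!: exec.intros ext)
next
  case (exec_Store a y z r M)
  then show ?case
    by (intro exI[of _ "(fst S, (snd S)(g a := (snd S (g a))(fst S (f y) := fst S (f z))))"])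
       (cases S; auto simp: same_outside_def pull_def inj_eq intro!: exec.intros ext)
next
  case (exec_Seq c1 s1 t1 s2 c2 t2 s3)
  then obtain S2 where S2: "exec W (rename f g c1) S t1 S2" "pull f g S2 = s2"
    "same_outside f g S S2" by blast
  with exec_Seq obtain S3 where "exec W (rename f g c2) S2 t2 S3" "pull f g S3 = s3"
    "same_outside f g S2 S3" by blast
  with S2 show ?case
    by (intro exI[of _ S3]) (auto simp: same_outside_def intro: exec.exec_Seq)
next
  case (exec_If_nonzero s x c1 t s' c2)
  then show ?case by (fastforce simp: pull_def intro: exec.intros)
next
  case (exec_If_zero s x c2 t s' c1)
  then show ?case by (fastforce simp: pull_def intro: exec.intros)
next
  case (exec_While_zero s x c)
  then show ?case
    by (intro exI[of _ S]) (auto simp: pull_def same_outside_def intro!: exec.exec_While_zero)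
next
  case (exec_While_nonzero s1 x c t1 s2 t2 s3)
  then obtain S2 where S2: "exec W (rename f g c) S t1 S2" "pull f g S2 = s2"
    "same_outside f g S S2" by blast
  with exec_While_nonzero obtain S3 where S3: "exec W (rename f g (WhileNZ x c)) S2 t2 S3"
    "pull f g S3 = s3" "same_outside f g S2 S3" by blast
  have "fst S (f x) \<noteq> 0" using exec_While_nonzero by (auto simp: pull_def)
  with S2 S3 have "exec W (rename f g (WhileNZ x c)) S (1 + t1 + t2) S3"
    by (auto intro: exec.exec_While_nonzero)
  with S2 S3 show ?case by (intro exI[of _ S3]) (auto simp: same_outside_def)
qed

section \<open>Compilation of expressions\<close>

datatype exp = Num nat | Var nat | Bin binop exp exp | Arr arr exp | Ite exp exp exp

fun eval :: "exp \<Rightarrow> (nat \<Rightarrow> nat) \<Rightarrow> (arr \<Rightarrow> nat \<Rightarrow> nat) \<Rightarrow> nat" where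
  "eval (Num n) \<sigma> M = n"
| "eval (Var x) \<sigma> M = \<sigma> x"
| "eval (Bin p a b) \<sigma> M = apply_op p (eval a \<sigma> M) (eval b \<sigma> M)"
| "eval (Arr a e) \<sigma> M = M a (eval e \<sigma> M)"
| "eval (Ite c a b) \<sigma> M = (if eval c \<sigma> M \<noteq> 0 then eval a \<sigma> M else eval b \<sigma> M)"

fun fits :: "nat \<Rightarrow> exp \<Rightarrow> (nat \<Rightarrow> nat) \<Rightarrow> (arr \<Rightarrow> nat \<Rightarrow> nat) \<Rightarrow> bool" where
  "fits W (Num n) \<sigma> M \<longleftrightarrow> n < W"
| "fits W (Var x) \<sigma> M \<longleftrightarrow> \<sigma> x < W"
| "fits W (Bin p a b) \<sigma> M \<longleftrightarrow> fits W a \<sigma> M \<and> fits W b \<sigma> M \<and> eval (Bin p a b) \<sigma> M < W"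
| "fits W (Arr a e) \<sigma> M \<longleftrightarrow> fits W e \<sigma> M \<and> eval (Arr a e) \<sigma> M < W"
| "fits W (Ite c a b) \<sigma> M \<longleftrightarrow>
     fits W c \<sigma> M \<and> (if eval c \<sigma> M \<noteq> 0 then fits W a \<sigma> M else fits W b \<sigma> M)"

text \<open>Register \<open>3 x\<close> holds the program variable \<open>x\<close>, registers \<open>3 d + 1\<close> hold intermediate
  results, and registers \<open>3 x + 2\<close> are left to an embedded program.\<close>

fun comp :: "nat \<Rightarrow> exp \<Rightarrow> com" where
  "comp d (Num n) = Const (3 * d + 1) n"
| "comp d (Var x) = Op Or (3 * d + 1) (3 * x) (3 * x)"
| "comp d (Bin p a b) =
     Seq (comp d a) (Seq (comp (Suc d) b) (Op p (3 * d + 1) (3 * d + 1) (3 * Suc d + 1)))"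
| "comp d (Arr a e) = Seq (comp d e) (Load (3 * d + 1) a (3 * d + 1))"
| "comp d (Ite c a b) = Seq (comp d c) (IfNZ (3 * d + 1) (comp d a) (comp d b))"

text \<open>Counts both branches of \<open>Ite\<close>, so that it does not depend on the state.
  Besides bounding the number of steps it will be the exponent in the bound on intermediate
  values.\<close>

fun cost :: "exp \<Rightarrow> nat" where
  "cost (Num n) = 1"
| "cost (Var x) = 1"
| "cost (Bin p a b) = 1 + cost a + cost b"
| "cost (Arr a e) = 1 + cost e"
| "cost (Ite c a b) = 1 + cost c + cost a + cost b"

text \<open>The temporaries form a stack indexed by \<open>d\<close>, and only those at depth
  \<open>d\<close> and above change. Hence the left operand survives the evaluation of the right one
  at depth \<open>Suc d\<close>, and program variables and the registers \<open>3 * x + 2\<close>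
  are preserved.\<close>

lemma exec_comp:
  assumes "fits W e \<sigma> M" "\<forall>x. r (3 * x) = \<sigma> x"
  shows "\<exists>t r'. t \<le> cost e \<and> exec W (comp d e) (r, M) t (r', M) \<and> r' (3 * d + 1) = eval e \<sigma> M \<and>
    (\<forall>y. (\<forall>d' \<ge> d. y \<noteq> 3 * d' + 1) \<longrightarrow> r' y = r y)"
  using assms
proof (induction e arbitrary: d r)
  case (Num n)
  then show ?case
    by (intro exI[of _ 1] exI[of _ "r(3 * d + 1 := n)"]) (auto simp del: fun_upd_apply intro: exec.intros, auto)
next
  case (Var x)
  then have "exec W (comp d (Var x)) (r, M) 1 (r(3 * d + 1 := apply_op Or (r (3 * x)) (r (3 * x))), M)"
    unfolding comp.simps by (intro exec_Op) auto
  with Var show ?case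
    by (intro exI[of _ 1] exI[of _ "r(3 * d + 1 := \<sigma> x)"]) (auto simp del: fun_upd_apply, auto)
next
  case (Bin p a b)
  have fa: "fits W a \<sigma> M" and fb: "fits W b \<sigma> M" and fp: "eval (Bin p a b) \<sigma> M < W"
    using Bin.prems by auto
  from Bin.IH(1)[OF fa Bin.prems(2)] obtain t1 r1 where 1: "t1 \<le> cost a"
    "exec W (comp d a) (r, M) t1 (r1, M)" "r1 (3 * d + 1) = eval a \<sigma> M"
    "\<forall>y. (\<forall>d' \<ge> d. y \<noteq> 3 * d' + 1) \<longrightarrow> r1 y = r y" by blast
  have r1: "\<forall>x. r1 (3 * x) = \<sigma> x" 
    by (intro allI trans[OF 1(4)[rule_format]]; use Bin.prems(2) in presburger)
  from Bin.IH(2)[OF fb r1] obtain t2 r2 where 2: "t2 \<le> cost b"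
    "exec W (comp (Suc d) b) (r1, M) t2 (r2, M)" "r2 (3 * Suc d + 1) = eval b \<sigma> M"
    "\<forall>y. (\<forall>d' \<ge> Suc d. y \<noteq> 3 * d' + 1) \<longrightarrow> r2 y = r1 y" by blast
  have r2: "r2 (3 * d + 1) = eval a \<sigma> M" using 2(4) 1(3) by auto
  define r3 where "r3 = r2(3 * d + 1 := apply_op p (r2 (3 * d + 1)) (r2 (3 * Suc d + 1)))"
  have "exec W (Op p (3 * d + 1) (3 * d + 1) (3 * Suc d + 1)) (r2, M) 1 (r3, M)"
    unfolding r3_def by (rule exec_Op) (use fp r2 2(3) in simp)
  with 1(2) 2(2) have "exec W (comp d (Bin p a b)) (r, M) (t1 + (t2 + 1)) (r3, M)"
    unfolding comp.simps by (blast intro: exec_Seq)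
  moreover have "\<forall>y. (\<forall>d' \<ge> d. y \<noteq> 3 * d' + 1) \<longrightarrow> r3 y = r y"
    using 1(4) 2(4) by (auto simp: r3_def)
  moreover have "r3 (3 * d + 1) = eval (Bin p a b) \<sigma> M" using 2(3) r2 by (simp add: r3_def)
  ultimately show ?case using 1(1) 2(1)
    by (intro exI[of _ "t1 + (t2 + 1)"] exI[of _ r3] conjI) auto
next
  case (Arr a e)
  then have fe: "fits W e \<sigma> M" and fp: "eval (Arr a e) \<sigma> M < W" by auto
  from Arr.IH[OF fe Arr.prems(2)] obtain t1 r1 where 1: "t1 \<le> cost e"
    "exec W (comp d e) (r, M) t1 (r1, M)" "r1 (3 * d + 1) = eval e \<sigma> M"
    "\<forall>y. (\<forall>d' \<ge> d. y \<noteq> 3 * d' + 1) \<longrightarrow> r1 y = r y" by blast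
  define r2 where "r2 = r1(3 * d + 1 := M a (r1 (3 * d + 1)))"
  have "exec W (Load (3 * d + 1) a (3 * d + 1)) (r1, M) 1 (r2, M)"
    unfolding r2_def by (rule exec_Load) (use fp 1(3) in simp)
  with 1(2) have "exec W (comp d (Arr a e)) (r, M) (t1 + 1) (r2, M)"
    unfolding comp.simps by (blast intro: exec_Seq)
  moreover have "r2 (3 * d + 1) = eval (Arr a e) \<sigma> M"
    "\<forall>y. (\<forall>d' \<ge> d. y \<noteq> 3 * d' + 1) \<longrightarrow> r2 y = r y"
    using 1(3,4) by (auto simp: r2_def)
  ultimately show ?case using 1(1)
    by (intro exI[of _ "t1 + 1"] exI[of _ r2] conjI) auto
next
  case (Ite c a b)
  then have fc: "fits W c \<sigma> M" by simp
  from Ite.IH(1)[OF fc Ite.prems(2)] obtain t1 r1 where 1: "t1 \<le> cost c"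
    "exec W (comp d c) (r, M) t1 (r1, M)" "r1 (3 * d + 1) = eval c \<sigma> M"
    "\<forall>y. (\<forall>d' \<ge> d. y \<noteq> 3 * d' + 1) \<longrightarrow> r1 y = r y" by blast
  have r1: "\<forall>x. r1 (3 * x) = \<sigma> x" 
    by (intro allI trans[OF 1(4)[rule_format]]; use Ite.prems(2) in presburger)
  show ?case
  proof (cases "eval c \<sigma> M = 0")
    case True
    then have "fits W b \<sigma> M" using Ite.prems by simp
    from Ite.IH(3)[OF this r1] obtain t2 r2 where 2: "t2 \<le> cost b"
      "exec W (comp d b) (r1, M) t2 (r2, M)" "r2 (3 * d + 1) = eval b \<sigma> M"
      "\<forall>y. (\<forall>d' \<ge> d. y \<noteq> 3 * d' + 1) \<longrightarrow> r2 y = r1 y" by blast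
    have "exec W (comp d (Ite c a b)) (r, M) (t1 + (1 + t2)) (r2, M)"
      unfolding comp.simps using 1 2 True by (intro exec_Seq exec_If_zero) auto
    then show ?thesis using 1 2 True by (intro exI[of _ "t1 + (1 + t2)"] exI[of _ r2]) auto
  next
    case False
    then have "fits W a \<sigma> M" using Ite.prems by simp
    from Ite.IH(2)[OF this r1] obtain t2 r2 where 2: "t2 \<le> cost a"
      "exec W (comp d a) (r1, M) t2 (r2, M)" "r2 (3 * d + 1) = eval a \<sigma> M"
      "\<forall>y. (\<forall>d' \<ge> d. y \<noteq> 3 * d' + 1) \<longrightarrow> r2 y = r1 y" by blast
    have "exec W (comp d (Ite c a b)) (r, M) (t1 + (1 + t2)) (r2, M)"
      unfolding comp.simps using 1 2 False by (intro exec_Seq exec_If_nonzero) auto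
    then show ?thesis using 1 2 False by (intro exI[of _ "t1 + (1 + t2)"] exI[of _ r2]) auto
  qed
qed

section \<open>Word size needed by an expression\<close>

fun no_shift :: "exp \<Rightarrow> bool" where
  "no_shift (Num n) \<longleftrightarrow> True"
| "no_shift (Var x) \<longleftrightarrow> True"
| "no_shift (Bin p a b) \<longleftrightarrow> p \<noteq> ShiftL \<and> no_shift a \<and> no_shift b"
| "no_shift (Arr a e) \<longleftrightarrow> no_shift e"
| "no_shift (Ite c a b) \<longleftrightarrow> no_shift c \<and> no_shift a \<and> no_shift b"

fun nums :: "exp \<Rightarrow> nat set" where
  "nums (Num n) = {n}"
| "nums (Var x) = {}"
| "nums (Bin p a b) = nums a \<union> nums b"
| "nums (Arr a e) = nums e"
| "nums (Ite c a b) = nums c \<union> nums a \<union> nums b"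

fun arrs :: "exp \<Rightarrow> arr set" where
  "arrs (Num n) = {}"
| "arrs (Var x) = {}"
| "arrs (Bin p a b) = arrs a \<union> arrs b"
| "arrs (Arr a e) = insert a (arrs e)"
| "arrs (Ite c a b) = arrs c \<union> arrs a \<union> arrs b"

lemma and_le_left: "Bit_Operations.and x y \<le> (x :: nat)"
proof -
  have "int (Bit_Operations.and x y) \<le> int x" unfolding of_nat_and_eq by (rule AND_upper1) simp
  then show ?thesis by simp
qed

lemma or_le_plus: "Bit_Operations.or x y \<le> x + (y :: nat)"
proof -
  have "int (Bit_Operations.or x y) \<le> int (x + y)"
    using plus_and_or[of "int x" "int y"] and_nonnegative_int_iff[of "int x" "int y"]
    unfolding of_nat_or_eq of_nat_add by linarith
  then show ?thesis by simp
qed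

lemma xor_le_plus: "Bit_Operations.xor x y \<le> x + (y :: nat)"
proof -
  have "Bit_Operations.xor x y + Bit_Operations.and x y
      = Bit_Operations.or (Bit_Operations.xor x y) (Bit_Operations.and x y)"
    by (rule disjunctive_add_eq_or) (auto simp: bit_eq_iff bit_simps)
  also have "\<dots> = Bit_Operations.or x y" by (auto simp: bit_eq_iff bit_simps)
  finally show ?thesis using or_le_plus[of x y] by linarith
qed

text \<open>The exponent follows the recursion of \<open>cost\<close> for \<open>Bin\<close>; the
  extra factor \<open>b\<close>, at least 2, pays for the sum in \<open>Plus\<close>,
  \<open>Or\<close> and \<open>Xor\<close>. A left shift is excluded because it grows exponentially
  in its second argument.\<close>

lemma apply_op_le:
  assumes "p \<noteq> ShiftL" "x \<le> b ^ i" "y \<le> b ^ j" "2 \<le> b"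
  shows "apply_op p x y \<le> b ^ (1 + i + j)"
proof -
  have ge: "1 \<le> b ^ i" "1 \<le> b ^ j" using assms(4) by simp_all
  have pw: "b * (b ^ i * b ^ j) = b ^ (1 + i + j)" by (simp add: power_add)
  have le: "b ^ i \<le> b ^ i * b ^ j" "b ^ j \<le> b ^ i * b ^ j"
    using ge by simp_all
  have two: "2 * (b ^ i * b ^ j) \<le> b ^ (1 + i + j)"
    unfolding pw[symmetric] using assms(4) by (intro mult_right_mono) simp_all
  have sum: "x + y \<le> b ^ (1 + i + j)" using assms le two by linarith
  have left: "a \<le> b ^ (1 + i + j)" if "a \<le> x" for a using that assms le two by linarith
  have prod: "x * y \<le> b ^ (1 + i + j)"
    using mult_le_mono[OF assms(2,3)] two by linarith
  show ?thesis
  proof (cases p)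
    case Plus
    then show ?thesis using sum by simp
  next
    case Times
    then show ?thesis using prod by simp
  next
    case Divide
    then show ?thesis using left[of "x div y"] by simp
  next
    case And
    then show ?thesis using left and_le_left by simp
  next
    case Minus
    then show ?thesis using left[of "x - y"] by simp
  next
    case Or
    then show ?thesis using sum or_le_plus[of x y] by simp
  next
    case Xor
    then show ?thesis using sum xor_le_plus[of x y] by simp
  next
    case ShiftR
    then show ?thesis using left[of "drop_bit y x"] by (simp add: drop_bit_eq_div)
  qed (use assms in simp)
qed

text \<open>Replaces a value analysis of every subexpression by the single inequality
  \<open>B ^ cost e < W\<close>.\<close>

lemma fits_if_bounded:
  assumes "no_shift e" "\<forall>n \<in> nums e. n \<le> B" "\<forall>x. \<sigma> x \<le> B" "\<forall>a \<in> arrs e. \<forall>i. M a i \<le> B"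
    and "2 \<le> B"
  shows "eval e \<sigma> M \<le> B ^ cost e" and "B ^ cost e < W \<Longrightarrow> fits W e \<sigma> M"
proof -
  have mono: "B ^ i \<le> B ^ j" if "i \<le> j" for i j
    using that assms(5) by (intro power_increasing) simp_all
  have le: "B \<le> B ^ (1 + j)" for j using mono[of 1 "1 + j"] by simp
  have "eval e \<sigma> M \<le> B ^ cost e \<and> (B ^ cost e < W \<longrightarrow> fits W e \<sigma> M)"
    using assms
  proof (induction e)
    case (Num n)
    then show ?case by auto
  next
    case (Var x)
    then have "\<sigma> x \<le> B" by simp
    then show ?case by auto
  next
    case (Bin p a b)
    have 1: "eval (Bin p a b) \<sigma> M \<le> B ^ (1 + cost a + cost b)"
      unfolding eval.simps using Bin by (intro apply_op_le) auto
    have 2: "B ^ cost a \<le> B ^ (1 + cost a + cost b)" "B ^ cost b \<le> B ^ (1 + cost a + cost b)"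
      by (intro mono; simp)+
    have "fits W a \<sigma> M" "fits W b \<sigma> M" if "B ^ (1 + cost a + cost b) < W"
      using le_less_trans[OF 2(1) that] le_less_trans[OF 2(2) that] Bin by simp_all
    then show ?case using 1 by (auto dest: le_less_trans)
  next
    case (Arr a e)
    have 1: "M a (eval e \<sigma> M) \<le> B ^ (1 + cost e)"
      by (rule order_trans[OF _ le]) (use Arr.prems in simp)
    have 2: "B ^ cost e \<le> B ^ (1 + cost e)" by (intro mono) simp
    have "fits W e \<sigma> M" if "B ^ (1 + cost e) < W"
      using le_less_trans[OF 2 that] Arr by simp
    then show ?case using 1 by (auto dest: le_less_trans)
  next
    case (Ite c a b)
    let ?k = "1 + cost c + cost a + cost b"
    have 2: "B ^ cost a \<le> B ^ ?k" "B ^ cost b \<le> B ^ ?k" "B ^ cost c \<le> B ^ ?k"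
      by (intro mono; simp)+
    have IH: "eval a \<sigma> M \<le> B ^ cost a" "eval b \<sigma> M \<le> B ^ cost b"
      "B ^ cost a < W \<Longrightarrow> fits W a \<sigma> M" "B ^ cost b < W \<Longrightarrow> fits W b \<sigma> M"
      "B ^ cost c < W \<Longrightarrow> fits W c \<sigma> M"
      using Ite by simp_all
    have "fits W c \<sigma> M \<and> fits W a \<sigma> M \<and> fits W b \<sigma> M" if "B ^ ?k < W"
      using that 2 IH(3-5) by (meson le_less_trans)
    then show ?case using order_trans[OF IH(1) 2(1)] order_trans[OF IH(2) 2(2)] by simp
  qed
  then show "eval e \<sigma> M \<le> B ^ cost e" "B ^ cost e < W \<Longrightarrow> fits W e \<sigma> M" by auto
qed

text \<open>A specification in terms of program variables and memory only. Temporaries are arbitrary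
  at the start and forgotten at the end, and \<open>t\<close> is merely an upper bound. The
  registers \<open>3 * x + 2\<close> keep their values so that the solver will find them
  zero.\<close>

definition steps :: "nat \<Rightarrow> com \<Rightarrow> (nat \<Rightarrow> nat) \<times> (arr \<Rightarrow> nat \<Rightarrow> nat) \<Rightarrow> nat \<Rightarrow>
    (nat \<Rightarrow> nat) \<times> (arr \<Rightarrow> nat \<Rightarrow> nat) \<Rightarrow> bool" where
  "steps W c s t s' \<longleftrightarrow> (\<forall>r. (\<forall>x. r (3 * x) = fst s x) \<longrightarrow>
     (\<exists>t' r'. t' \<le> t \<and> exec W c (r, snd s) t' (r', snd s') \<and> (\<forall>x. r' (3 * x) = fst s' x) \<and>
        (\<forall>x. r' (3 * x + 2) = r (3 * x + 2))))"

lemma steps_Seq: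
  assumes "steps W c s t s'" "steps W d s' u s''"
  shows "steps W (Seq c d) s (t + u) s''"
  unfolding steps_def
proof (intro allI impI)
  fix r assume "\<forall>x. r (3 * x) = fst s x"
  then obtain t' r' where 1: "t' \<le> t" "exec W c (r, snd s) t' (r', snd s')"
    "\<forall>x. r' (3 * x) = fst s' x" "\<forall>x. r' (3 * x + 2) = r (3 * x + 2)"
    using assms(1) unfolding steps_def by blast
  then obtain u' r'' where 2: "u' \<le> u" "exec W d (r', snd s') u' (r'', snd s'')"
    "\<forall>x. r'' (3 * x) = fst s'' x" "\<forall>x. r'' (3 * x + 2) = r' (3 * x + 2)"
    using assms(2) unfolding steps_def by blast
  show "\<exists>t' r'. t' \<le> t + u \<and> exec W (Seq c d) (r, snd s) t' (r', snd s'') \<and>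
      (\<forall>x. r' (3 * x) = fst s'' x) \<and> (\<forall>x. r' (3 * x + 2) = r (3 * x + 2))"
    using 1 2 by (intro exI[of _ "t' + u'"] exI[of _ r'']) (auto intro: exec_Seq)
qed

lemma steps_weaken: "steps W c s t s' \<Longrightarrow> t \<le> u \<Longrightarrow> s' = s'' \<Longrightarrow> steps W c s u s''"
  unfolding steps_def by (meson order_trans)

text \<open>The instruction set has no move; \<open>Or\<close> of a register with itself copies it.
  Register 1 is the temporary of depth 0.\<close>

definition Asg :: "nat \<Rightarrow> exp \<Rightarrow> com" where
  "Asg x e = Seq (comp 0 e) (Op Or (3 * x) 1 1)"

lemma eval_lt: "fits W e \<sigma> M \<Longrightarrow> eval e \<sigma> M < W"
  by (induction e) auto

lemma steps_Asg:
  assumes "fits W e \<sigma> M"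
  shows "steps W (Asg x e) (\<sigma>, M) (1 + cost e) (\<sigma>(x := eval e \<sigma> M), M)"
  unfolding steps_def fst_conv snd_conv
proof (intro allI impI)
  fix r :: "nat \<Rightarrow> nat" assume r: "\<forall>x. r (3 * x) = \<sigma> x"
  from exec_comp[OF assms r, of 0] obtain t r' where 1: "t \<le> cost e"
    "exec W (comp 0 e) (r, M) t (r', M)" "r' 1 = eval e \<sigma> M"
    "\<forall>y. (\<forall>d. y \<noteq> 3 * d + 1) \<longrightarrow> r' y = r y" by auto
  have a: "\<forall>y. r' (3 * y) = r (3 * y)" "\<forall>y. r' (3 * y + 2) = r (3 * y + 2)"
    by (intro allI 1(4)[rule_format]; presburger)+
  have "exec W (Op Or (3 * x) 1 1) (r', M) 1 (r'(3 * x := apply_op Or (r' 1) (r' 1)), M)"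
    using 1(3) eval_lt[OF assms] by (intro exec_Op) auto
  with 1(2) have "exec W (Asg x e) (r, M) (t + 1) (r'(3 * x := eval e \<sigma> M), M)"
    unfolding Asg_def using 1(3) by (auto intro: exec_Seq)
  moreover have "3 * y + 2 \<noteq> 3 * x" for y by presburger
  ultimately show "\<exists>t' r'. t' \<le> 1 + cost e \<and> exec W (Asg x e) (r, M) t' (r', M) \<and>
      (\<forall>y. r' (3 * y) = (\<sigma>(x := eval e \<sigma> M)) y) \<and> (\<forall>y. r' (3 * y + 2) = r (3 * y + 2))"
    using 1 a r by (intro exI[of _ "t + 1"] exI[of _ "r'(3 * x := eval e \<sigma> M)"]) auto
qed

text \<open>Registers 1 and 4 are the temporaries of depths 0 and 1, holding address and
  value.\<close>

definition Sto :: "arr \<Rightarrow> exp \<Rightarrow> exp \<Rightarrow> com" where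
  "Sto a i e = Seq (comp 0 i) (Seq (comp 1 e) (Store a 1 4))"

lemma steps_Sto:
  assumes "fits W i \<sigma> M" "fits W e \<sigma> M"
  shows "steps W (Sto a i e) (\<sigma>, M) (1 + cost i + cost e)
           (\<sigma>, M(a := (M a)(eval i \<sigma> M := eval e \<sigma> M)))"
  unfolding steps_def fst_conv snd_conv
proof (intro allI impI)
  fix r :: "nat \<Rightarrow> nat" assume r: "\<forall>x. r (3 * x) = \<sigma> x"
  from exec_comp[OF assms(1) r, of 0] obtain t r' where 1: "t \<le> cost i"
    "exec W (comp 0 i) (r, M) t (r', M)" "r' 1 = eval i \<sigma> M"
    "\<forall>y. (\<forall>d. y \<noteq> 3 * d + 1) \<longrightarrow> r' y = r y" by auto
  have a: "\<forall>y. r' (3 * y) = r (3 * y)" "\<forall>y. r' (3 * y + 2) = r (3 * y + 2)"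
    by (intro allI 1(4)[rule_format]; presburger)+
  then have r': "\<forall>x. r' (3 * x) = \<sigma> x" using r by simp
  from exec_comp[OF assms(2) r', of 1] obtain u s where 2: "u \<le> cost e"
    "exec W (comp 1 e) (r', M) u (s, M)" "s 4 = eval e \<sigma> M"
    "\<forall>y. (\<forall>d\<ge>1. y \<noteq> 3 * d + 1) \<longrightarrow> s y = r' y" by auto
  have b: "\<forall>y. s (3 * y) = r' (3 * y)" "\<forall>y. s (3 * y + 2) = r' (3 * y + 2)" "s 1 = r' 1"
    by (intro allI 2(4)[rule_format]; presburger)+
  have "exec W (Store a 1 4) (s, M) 1 (s, M(a := (M a)(s 1 := s 4)))" by (rule exec_Store)
  with 1(2) 2(2) have "exec W (Sto a i e) (r, M) (t + (u + 1)) (s, M(a := (M a)(s 1 := s 4)))"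
    unfolding Sto_def by (blast intro: exec_Seq)
  then show "\<exists>t' r'. t' \<le> 1 + cost i + cost e \<and>
      exec W (Sto a i e) (r, M) t' (r', M(a := (M a)(eval i \<sigma> M := eval e \<sigma> M))) \<and>
      (\<forall>y. r' (3 * y) = \<sigma> y) \<and> (\<forall>y. r' (3 * y + 2) = r (3 * y + 2))"
    using 1 2 a b r by (intro exI[of _ "t + (u + 1)"] exI[of _ s]) auto
qed

definition For :: "nat \<Rightarrow> nat \<Rightarrow> com \<Rightarrow> com" where
  "For x y c = Seq (Asg x (Num 0)) (Seq (comp 0 (Bin Minus (Var y) (Var x)))
     (WhileNZ 1 (Seq c (Seq (Asg x (Bin Plus (Var x) (Num 1)))
        (comp 0 (Bin Minus (Var y) (Var x)))))))"

text \<open>\<open>\<sigma> i\<close> is the variable store before round \<open>i\<close>,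
  \<open>\<sigma>' i\<close> the one after the body and before the increment. A round costs
  \<open>u\<close>, 1 for the loop test, 4 for the increment and 3 for recomputing the truncated
  difference; the final 6 is 2 for clearing the counter, 3 for the first difference and 1 for
  leaving the loop.\<close>

lemma steps_For:
  assumes body: "\<And>i. i < n \<Longrightarrow> steps W c (\<sigma> i, M i) u (\<sigma>' i, M (Suc i))"
    and counter: "\<And>i. i < n \<Longrightarrow> \<sigma>' i x = i" "\<And>i. i < n \<Longrightarrow> \<sigma> (Suc i) = (\<sigma>' i)(x := Suc i)"
    and init: "\<sigma> 0 = \<sigma>0(x := 0)" and limit: "\<And>i. i \<le> n \<Longrightarrow> \<sigma> i y = n" and W: "Suc n < W"
  shows "steps W (For x y c) (\<sigma>0, M 0) (n * (u + 8) + 6) (\<sigma> n, M n)"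
proof -
  let ?d = "Bin Minus (Var y) (Var x)" and ?inc = "Asg x (Bin Plus (Var x) (Num 1))"
  let ?w = "WhileNZ 1 (Seq c (Seq ?inc (comp 0 ?d)))"
  have cnt: "\<sigma> i x = i" if "i \<le> n" for i
    using that init counter(2) by (cases i) auto
  have test: "\<exists>t r'. t \<le> 3 \<and> exec W (comp 0 ?d) (r, M i) t (r', M i) \<and> r' 1 = n - i \<and>
      (\<forall>y. r' (3 * y) = \<sigma> i y) \<and> (\<forall>y. r' (3 * y + 2) = r (3 * y + 2))"
    if "i \<le> n" "\<forall>y. r (3 * y) = \<sigma> i y" for i r
  proof -
    have "fits W ?d (\<sigma> i) (M i)" using W cnt[OF that(1)] limit[OF that(1)] that(1) by auto
    from exec_comp[OF this that(2), of 0] obtain t r' where 1: "t \<le> cost ?d"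
      "exec W (comp 0 ?d) (r, M i) t (r', M i)" "r' 1 = eval ?d (\<sigma> i) (M i)"
      "\<forall>y. (\<forall>d. y \<noteq> 3 * d + 1) \<longrightarrow> r' y = r y" by auto
    have a: "\<forall>y. r' (3 * y) = r (3 * y)" "\<forall>y. r' (3 * y + 2) = r (3 * y + 2)"
      by (intro allI 1(4)[rule_format]; presburger)+
    show ?thesis using 1 a that cnt[OF that(1)] limit[OF that(1)]
      by (intro exI[of _ t] exI[of _ r']) auto
  qed
  have loop: "\<exists>t' r'. t' \<le> (n - i) * (u + 8) + 1 \<and> exec W ?w (r, M i) t' (r', M n) \<and>
      (\<forall>y. r' (3 * y) = \<sigma> n y) \<and> (\<forall>y. r' (3 * y + 2) = r (3 * y + 2))"
    if "i \<le> n" "r 1 = n - i" "\<forall>y. r (3 * y) = \<sigma> i y" for i r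
    using that
  proof (induction "n - i" arbitrary: i r)
    case 0
    then have "i = n" by simp
    with 0 have "exec W ?w (r, M i) 1 (r, M n)" by (auto intro: exec_While_zero)
    with 0 \<open>i = n\<close> show ?case by auto
  next
    case (Suc k)
    then have i: "i < n" by simp
    obtain t1 r1 where 1: "t1 \<le> u" "exec W c (r, M i) t1 (r1, M (Suc i))"
      "\<forall>y. r1 (3 * y) = \<sigma>' i y" "\<forall>y. r1 (3 * y + 2) = r (3 * y + 2)"
      using body[OF i] Suc.prems(3) unfolding steps_def by auto
    have "fits W (Bin Plus (Var x) (Num 1)) (\<sigma>' i) (M (Suc i))"
      using counter(1)[OF i] W i by auto
    from steps_Asg[OF this, of x] have "steps W ?inc (\<sigma>' i, M (Suc i)) 4 (\<sigma> (Suc i), M (Suc i))"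
      using counter[OF i] by (simp add: eval_nat_numeral One_nat_def)
    then obtain t2 r2 where 2: "t2 \<le> 4" "exec W ?inc (r1, M (Suc i)) t2 (r2, M (Suc i))"
      "\<forall>y. r2 (3 * y) = \<sigma> (Suc i) y" "\<forall>y. r2 (3 * y + 2) = r1 (3 * y + 2)"
      using 1 unfolding steps_def by auto
    from test[OF _ 2(3)] i obtain t3 r3 where 3: "t3 \<le> 3"
      "exec W (comp 0 ?d) (r2, M (Suc i)) t3 (r3, M (Suc i))" "r3 1 = n - Suc i"
      "\<forall>y. r3 (3 * y) = \<sigma> (Suc i) y" "\<forall>y. r3 (3 * y + 2) = r2 (3 * y + 2)" by auto
    have k: "k = n - Suc i" "Suc i \<le> n" using Suc.hyps(2) i by simp_all
    from Suc.hyps(1)[OF k 3(3,4)] obtain t4 r4 where 4: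
      "t4 \<le> (n - Suc i) * (u + 8) + 1" "exec W ?w (r3, M (Suc i)) t4 (r4, M n)"
      "\<forall>y. r4 (3 * y) = \<sigma> n y" "\<forall>y. r4 (3 * y + 2) = r3 (3 * y + 2)" by blast
    have "exec W ?w (r, M i) (1 + (t1 + (t2 + t3)) + t4) (r4, M n)"
      by (rule exec_While_nonzero[OF _ exec_Seq[OF 1(2) exec_Seq[OF 2(2) 3(2)]] 4(2)])
        (use Suc.prems i in simp)
    moreover have "n - i = Suc (n - Suc i)" using i by simp
    then have "1 + (t1 + (t2 + t3)) + t4 \<le> (n - i) * (u + 8) + 1"
      using 1(1) 2(1) 3(1) 4(1) by simp
    ultimately show ?case using 1(4) 2(4) 3(5) 4(3,4)
      by (intro exI[of _ "1 + (t1 + (t2 + t3)) + t4"] exI[of _ r4] conjI) simp_all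
  qed
  show ?thesis unfolding steps_def fst_conv snd_conv
  proof (intro allI impI)
    fix r :: "nat \<Rightarrow> nat" assume r: "\<forall>x. r (3 * x) = \<sigma>0 x"
    have "fits W (Num 0) \<sigma>0 (M 0)" using W by auto
    from steps_Asg[OF this, of x] have "steps W (Asg x (Num 0)) (\<sigma>0, M 0) 2 (\<sigma> 0, M 0)"
      using init by (auto simp: numeral_2_eq_2)
    then obtain t1 r1 where 1: "t1 \<le> 2" "exec W (Asg x (Num 0)) (r, M 0) t1 (r1, M 0)"
      "\<forall>y. r1 (3 * y) = \<sigma> 0 y" "\<forall>y. r1 (3 * y + 2) = r (3 * y + 2)"
      using r unfolding steps_def by auto
    from test[OF _ 1(3)] obtain t2 r2 where 2: "t2 \<le> 3"
      "exec W (comp 0 ?d) (r1, M 0) t2 (r2, M 0)" "r2 1 = n - 0"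
      "\<forall>y. r2 (3 * y) = \<sigma> 0 y" "\<forall>y. r2 (3 * y + 2) = r1 (3 * y + 2)" by auto
    from loop[OF _ 2(3,4)] obtain t3 r3 where 3: "t3 \<le> n * (u + 8) + 1"
      "exec W ?w (r2, M 0) t3 (r3, M n)"
      "\<forall>y. r3 (3 * y) = \<sigma> n y" "\<forall>y. r3 (3 * y + 2) = r2 (3 * y + 2)" by auto
    have "exec W (For x y c) (r, M 0) (t1 + (t2 + t3)) (r3, M n)"
      unfolding For_def by (rule exec_Seq[OF 1(2) exec_Seq[OF 2(2) 3(2)]])
    then show "\<exists>t' r'. t' \<le> n * (u + 8) + 6 \<and> exec W (For x y c) (r, M 0) t' (r', M n) \<and>
        (\<forall>x. r' (3 * x) = \<sigma> n x) \<and> (\<forall>x. r' (3 * x + 2) = r (3 * x + 2))"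
      using 1 2 3 by (intro exI[of _ "t1 + (t2 + t3)"] exI[of _ r3]) auto
  qed
qed

section \<open>The automaton\<close>

text \<open>State 0 is initial and state 1 final, both with a loop for every letter; state
  \<open>a (M + 1) + j + 2\<close> expects the \<open>j\<close>-th letter of a block, for the half-assignment \<open>a\<close>. Letter 2
  opens a block, and the letter at position \<open>j > 0\<close> concerns clause \<open>j - 1\<close>. If \<open>a\<close> does not satisfy
  that clause, letter 1 is replaced by letter 3, which does not occur in the word: this way the
  number of transitions does not depend on the formula.\<close>

definition edge :: "nat \<Rightarrow> nat \<Rightarrow> (nat \<Rightarrow> nat \<Rightarrow> bool) \<Rightarrow> nat \<Rightarrow> nat \<times> nat option \<times> nat" where
  "edge M N S t = (let g = t div 2; r = t mod 2; j = g mod Suc M; c = g - N * Suc M in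
     if g < N * Suc M then
       if j = 0 \<and> r = 1 then (0, None, g + 2)
       else (g + 2,
         Some (if j = 0 then 2 else if r = 0 then 0 else if S (g div Suc M) (j - 1) then 1 else 3),
         if j = M then 1 else g + 3)
     else (c div 2, Some (2 * (c mod 2) + r), c div 2))"

text \<open>Transitions are numbered so that a loop can write them by a formula. Numbers
  \<open>2 * g\<close> and \<open>2 * g + 1\<close> are the two transitions out of block state
  \<open>g + 2\<close>; a first position of a block needs only one, and its second slot holds the
  epsilon-transition from state 0 into the block. The last 8 numbers are the loops: two states, four
  letters.\<close>

definition automaton :: "nat \<Rightarrow> nat \<Rightarrow> (nat \<Rightarrow> nat \<Rightarrow> bool) \<Rightarrow> (nat, nat) enfa" where
  "automaton M N S = \<lparr>states = {..<N * Suc M + 2}, alphabet = {..<4}, start = 0, final = 1,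
     trans = edge M N S ` {..<2 * (N * Suc M + 4)}\<rparr>"

definition letter :: "nat \<Rightarrow> (nat \<Rightarrow> nat \<Rightarrow> bool) \<Rightarrow> nat \<Rightarrow> nat" where
  "letter M S i = (if i mod Suc M = 0 then 2 else if S (i div Suc M) (i mod Suc M - 1) then 0 else 1)"

definition word :: "nat \<Rightarrow> nat \<Rightarrow> (nat \<Rightarrow> nat \<Rightarrow> bool) \<Rightarrow> nat list" where
  "word M N S = map (letter M S) [0..<N * Suc M]"

lemma block_index:
  assumes "a < N" "j \<le> M"
  shows "a * Suc M + j < N * Suc M" "(a * Suc M + j) div Suc M = a" "(a * Suc M + j) mod Suc M = j"
proof -
  have "a * Suc M + j < Suc a * Suc M" using assms by simp
  also have "\<dots> \<le> N * Suc M" using assms by (intro mult_le_mono1) simp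
  finally show "a * Suc M + j < N * Suc M" .
  show "(a * Suc M + j) div Suc M = a"
    using assms by (subst div_mult_self3) simp_all
  show "(a * Suc M + j) mod Suc M = j"
    using assms by (subst mod_mult_self3) simp_all
qed

lemma double_plus:
  fixes g r :: nat
  assumes "r < 2"
  shows "(2 * g + r) div 2 = g" "(2 * g + r) mod 2 = r"
  using assms by presburger+

lemma double_plus_less: "g < h \<Longrightarrow> r < 2 \<Longrightarrow> 2 * g + r < 2 * (h :: nat)"
  by linarith

text \<open>\<open>match_enc\<close> wants a list of transitions without repetition, and the running
  time depends on their number. Letters 1 and 3 have the same parity, so exchanging them for an
  unsatisfied clause does no harm.\<close>

lemma inj_edge: "inj_on (edge M N S) {..<2 * (N * Suc M + 4)}"
proof (rule inj_on_inverseI)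
  text \<open>The inverse recovers the parity of \<open>t\<close> from that of the letter.\<close>
  let ?inv = "\<lambda>(p, l, q). case l of None \<Rightarrow> 2 * (q - 2) + 1
    | Some c \<Rightarrow> if p < 2 then 2 * (N * Suc M + 2 * p + c div 2) + c mod 2 else 2 * (p - 2) + c mod (2::nat)"
  fix t assume "t \<in> {..<2 * (N * Suc M + 4)}"
  then have lt: "t div 2 - N * Suc M < 4" by auto
  define g r where "g = t div 2" and "r = t mod 2"
  have t: "t = 2 * g + r" "t div 2 = g" "t mod 2 = r" and r: "r = 0 \<or> r = 1"
    by (auto simp: g_def r_def)
  show "?inv (edge M N S t) = t"
  proof (cases "g < N * Suc M")
    case True
    then show ?thesis using r unfolding edge_def Let_def t(2,3) t(1) by auto
  next
    case False
    define c where "c = g - N * Suc M"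
    have c: "c div 2 < 2" "g = N * Suc M + c" using lt False t(2) by (auto simp: c_def)
    moreover have "2 * (c div 2) + c mod 2 = c" by simp
    ultimately show ?thesis
      using False r double_plus[of r "c mod 2"] unfolding edge_def Let_def t(2,3) c_def[symmetric]
      by (auto simp: t(1))
  qed
qed

lemma wf_automaton: "wf_enfa (automaton M N S)"
proof -
  have "edge M N S t \<in> {..<N * Suc M + 2} \<times> insert None (Some ` {..<4}) \<times> {..<N * Suc M + 2}"
    if "t < 2 * (N * Suc M + 4)" for t
  proof (cases "t div 2 < N * Suc M")
    case True
    \<comment> \<open>Unless the block ends, the target \<open>g + 3\<close> must again be a block
      state.\<close>
    have "t div 2 + 1 < N * Suc M" if "t div 2 mod Suc M \<noteq> M"
    proof -
      have "t div 2 div Suc M < N" using True by (simp add: less_mult_imp_div_less)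
      moreover have "Suc (t div 2 mod Suc M) \<le> M"
        using that by (metis Suc_leI less_Suc_eq mod_less_divisor zero_less_Suc)
      ultimately have "t div 2 div Suc M * Suc M + Suc (t div 2 mod Suc M) < N * Suc M"
        by (rule block_index)
      then show ?thesis by (metis Suc_eq_plus1 add_Suc_right div_mult_mod_eq)
    qed
    with True show ?thesis by (auto simp: edge_def Let_def)
  next
    case False
    with that have "t div 2 - N * Suc M < 4" by auto
    with False show ?thesis by (auto simp: edge_def Let_def)
  qed
  then have "edge M N S ` {..<2 * (N * Suc M + 4)} \<subseteq>
      {..<N * Suc M + 2} \<times> insert None (Some ` {..<4}) \<times> {..<N * Suc M + 2}" by blast
  then show ?thesis unfolding wf_enfa_def automaton_def enfa.simps by simp
qed

text \<open>Joins the two slots at position \<open>j\<close> of the block of \<open>a\<close>.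
  Letter 0 always passes, as it says that the first half already satisfies the clause.\<close>

definition allowed :: "(nat \<Rightarrow> nat \<Rightarrow> bool) \<Rightarrow> nat \<Rightarrow> nat \<Rightarrow> nat \<Rightarrow> bool" where
  "allowed S a j c \<longleftrightarrow> (if j = 0 then c = 2 else c = 0 \<or> (if S a (j - 1) then c = 1 else c = 3))"

definition next_state :: "nat \<Rightarrow> nat \<Rightarrow> nat \<Rightarrow> nat" where
  "next_state M a j = (if j = M then 1 else a * Suc M + Suc j + 2)"

lemma edge_loop:
  assumes "q < 2" "c < 4"
  shows "(q, Some c, q) \<in> trans (automaton M N S)"
proof -
  define t where "t = 2 * (N * Suc M + (2 * q + c div 2)) + c mod 2"
  have t: "t div 2 = N * Suc M + (2 * q + c div 2)" "t mod 2 = c mod 2"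
    unfolding t_def by (rule double_plus; simp)+
  have c: "c div 2 < 2" "(2 * q + c div 2) div 2 = q" "(2 * q + c div 2) mod 2 = c div 2"
    using assms by auto
  have "edge M N S t = (q, Some c, q)" using c by (simp add: edge_def Let_def t)
  moreover have "t < 2 * (N * Suc M + 4)" 

    unfolding t_def by (intro double_plus_less add_strict_left_mono) (use assms c(1) in linarith, simp)
  ultimately show ?thesis by (force simp: automaton_def)
qed

lemma edge_start:
  assumes "a < N"
  shows "(0, None, a * Suc M + 2) \<in> trans (automaton M N S)"
proof -
  define t where "t = 2 * (a * Suc M) + 1"
  have t: "t div 2 = a * Suc M" "t mod 2 = 1" unfolding t_def by (rule double_plus; simp)+
  note ix = block_index[OF assms, of 0 M, unfolded add_0_right, OF le0]
  have "edge M N S t = (0, None, a * Suc M + 2)"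
    unfolding edge_def Let_def t ix using ix(1) by simp
  moreover have "t < 2 * (N * Suc M + 4)" 
    unfolding t_def using ix(1) by (intro double_plus_less) simp_all
  ultimately show ?thesis by (force simp: automaton_def)
qed

lemma edge_block:
  assumes "a < N" "j \<le> M" "allowed S a j c"
  shows "(a * Suc M + j + 2, Some c, next_state M a j) \<in> trans (automaton M N S)"
proof -
  define r where "r = (if j = 0 \<or> c = 0 then 0 else 1 :: nat)"
  define t where "t = 2 * (a * Suc M + j) + r"
  note ix = block_index[OF assms(1,2)]
  have t: "t div 2 = a * Suc M + j" "t mod 2 = r"
    unfolding t_def r_def by (rule double_plus; simp)+
  have "edge M N S t = (a * Suc M + j + 2, Some c, next_state M a j)"
    unfolding edge_def Let_def t ix using ix(1) assms(3)
    by (auto simp: r_def allowed_def next_state_def)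
  moreover have "t < 2 * (N * Suc M + 4)" using ix(1) unfolding t_def r_def by simp
  ultimately show ?thesis by (force simp: automaton_def)
qed

text \<open>Converse of the three preceding lemmas; it hides the arithmetic of the numbering from
  all reasoning on paths.\<close>

lemma edge_cases:
  assumes "(p, l, q) \<in> trans (automaton M N S)"
  obtains (loop) c where "p < 2" "q = p" "l = Some c"
  | (start) a where "a < N" "p = 0" "l = None" "q = a * Suc M + 2"
  | (block) a j c where "a < N" "j \<le> M" "p = a * Suc M + j + 2" "l = Some c" "allowed S a j c"
      "q = next_state M a j"
proof -
  obtain t where t: "t < 2 * (N * Suc M + 4)" "(p, l, q) = edge M N S t"
    using assms by (auto simp: automaton_def)
  show ?thesis
  proof (cases "t div 2 < N * Suc M")
    case True
    define a j where "a = t div 2 div Suc M" and "j = t div 2 mod Suc M"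
    have a: "a < N" using True by (simp add: a_def less_mult_imp_div_less)
    have j: "j \<le> M" unfolding j_def by (simp add: less_Suc_eq_le[symmetric])
    have g: "t div 2 = a * Suc M + j" 
      unfolding a_def j_def by (rule div_mult_mod_eq[symmetric])
    have r: "t mod 2 = 0 \<or> t mod 2 = 1" by auto
    note ix = block_index[OF a j]
    show ?thesis
    proof (cases "j = 0 \<and> t mod 2 = 1")
      case True
      with t(2) ix(1) have "p = 0" "l = None" "q = a * Suc M + 2"
        unfolding edge_def Let_def g ix by auto
      with a show ?thesis by (rule start)
    next
      case False
      define c where
        "c = (if j = 0 then 2 else if t mod 2 = 0 then 0 else if S a (j - 1) then 1 else 3 :: nat)"
      have "p = a * Suc M + j + 2" "l = Some c" "q = next_state M a j"
        using t(2) ix(1) False unfolding edge_def Let_def g ix c_def[symmetric]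
        by (auto simp: next_state_def)
      moreover have "allowed S a j c" unfolding allowed_def c_def using False r by auto
      ultimately show ?thesis using block[OF a j] by blast
    qed
  next
    case False
    with t have "t div 2 - N * Suc M < 4" by auto
    with t(2) False show ?thesis by (intro loop) (auto simp: edge_def Let_def)
  qed
qed

section \<open>Accepting paths and the language of the automaton\<close>

lemma path_append: "path \<delta> p u q \<Longrightarrow> path \<delta> q v r \<Longrightarrow> path \<delta> p (u @ v) r"
  by (induction rule: path.induct) (auto intro: path.intros)

lemma path_loops:
  assumes "q < 2" "u \<in> lists {..<4}"
  shows "path (trans (automaton M N S)) q u q"
  using assms(2)
proof (induction u)
  case (Cons c u)
  then show ?case by (intro path_sym[OF edge_loop[OF assms(1)]]) auto
qed (auto intro: path.intros)

lemma path_block: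
  assumes "a < N" "j \<le> M" "length v = Suc M - j" "\<forall>i < length v. allowed S a (j + i) (v ! i)"
  shows "path (trans (automaton M N S)) (a * Suc M + j + 2) v 1"
  using assms(2-)
proof (induction v arbitrary: j)
  case (Cons c v)
  have "allowed S a j c" using Cons.prems(3) by force
  from edge_block[OF assms(1) Cons.prems(1) this]
  have e: "(a * Suc M + j + 2, Some c, next_state M a j) \<in> trans (automaton M N S)" .
  show ?case
  proof (cases "j = M")
    case True
    then have "v = []" using Cons.prems(2) by simp
    with e True show ?thesis by (auto simp: next_state_def intro: path.intros)
  next
    case False
    have "allowed S a (Suc j + i) (v ! i)" if "i < length v" for i
      using Cons.prems(3)[rule_format, of "Suc i"] that by simp
    then have "path (trans (automaton M N S)) (a * Suc M + Suc j + 2) v 1"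
      using Cons.prems False by (intro Cons.IH) auto
    with e False show ?thesis by (auto simp: next_state_def intro: path_sym)
  qed
qed simp

text \<open>Before entering a block a path can only loop at 0; once in the block of \<open>a\<close>
  it is forced on to state 1, checking one letter after the other against \<open>a\<close>. The
  claims on state 0 and on block states go through one induction because the epsilon-transition
  leads from the former to the latter.\<close>

lemma path_to_final:
  assumes "path (trans (automaton M N S)) p u q" "q = 1"
  shows "(p = 0 \<longrightarrow> (\<exists>i a. a < N \<and> i + M < length u \<and> (\<forall>j \<le> M. allowed S a j (u ! (i + j))))) \<and>
    (\<forall>a < N. \<forall>j \<le> M. p = a * Suc M + j + 2 \<longrightarrow>
       M - j < length u \<and> (\<forall>i. j + i \<le> M \<longrightarrow> allowed S a (j + i) (u ! i)))"
  using assms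
proof (induction rule: path.induct)
  case (path_refl p)
  then show ?case by simp
next
  case (path_eps p r u q)
  from path_eps.hyps(1) show ?case
  proof (cases rule: edge_cases)
    case (start a)
    with path_eps have "M - 0 < length u" "\<forall>i. 0 + i \<le> M \<longrightarrow> allowed S a (0 + i) (u ! i)"
      by fastforce+
    with start show ?thesis by (intro conjI impI exI[of _ 0] exI[of _ a]; simp)
  qed auto
next
  case (path_sym p c r u q)
  from path_sym.hyps(1) show ?case
  proof (cases rule: edge_cases)
    case (loop c')
    have "\<exists>i a. a < N \<and> i + M < length (c # u) \<and> (\<forall>j \<le> M. allowed S a j ((c # u) ! (i + j)))"
      if p: "p = 0"
    proof -
      obtain i a where "a < N" "i + M < length u" "\<forall>j \<le> M. allowed S a j (u ! (i + j))"
        using path_sym p loop by auto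
      then show ?thesis by (intro exI[of _ "Suc i"] exI[of _ a]) auto
    qed
    with loop show ?thesis by auto
  next
    case (block a j c')
    have "M - j < length (c # u) \<and> (\<forall>i. j + i \<le> M \<longrightarrow> allowed S a (j + i) ((c # u) ! i))"
    proof (cases "j = M")
      case True
      with block show ?thesis by auto
    next
      case False
      have IH: "M - Suc j < length u" "\<forall>i. Suc j + i \<le> M \<longrightarrow> allowed S a (Suc j + i) (u ! i)"
        using path_sym.IH path_sym.prems block False by (auto simp: next_state_def)
      have "allowed S a (j + i) ((c # u) ! i)" if "j + i \<le> M" for i
        using that IH(2) block by (cases i) auto
      with IH(1) False block(2) show ?thesis by auto
    qed
    \<comment> \<open>State numbers determine block and position, so the state in the claim is the
      one found by the case distinction.\<close>
    moreover have "a' = a \<and> j' = j" if "a' < N" "j' \<le> M" "p = a' * Suc M + j' + 2" for a' j'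
    proof -
      have "a' * Suc M + j' = a * Suc M + j" using that block(3) by simp
      with block_index[OF that(1,2)] block_index[OF block(1,2)] show ?thesis by metis
    qed
    ultimately show ?thesis using block(3) by auto
  qed auto
qed

text \<open>Letter 2 synchronises the two sides: the automaton can enter a block only where the word
  has letter 2, that is, at a multiple of \<open>Suc M\<close>. Inside the block, letter 1 passes
  only if the second half satisfies the clause.\<close>

theorem word_in_lang_iff:
  "word M N1 S1 \<in> lang (automaton M N2 S2) \<longleftrightarrow>
     (\<exists>b < N1. \<exists>a < N2. \<forall>j < M. S1 b j \<or> S2 a j)"
proof
  let ?w = "word M N1 S1" and ?\<delta> = "trans (automaton M N2 S2)"
  assume "?w \<in> lang (automaton M N2 S2)"
  then have "path ?\<delta> 0 ?w 1" by (simp add: lang_def automaton_def)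
  from path_to_final[OF this] obtain i a where a: "a < N2" and i: "i + M < N1 * Suc M"
    and all: "\<forall>j \<le> M. allowed S2 a j (?w ! (i + j))" by (auto simp: word_def)
  have w: "?w ! (i + j) = letter M S1 (i + j)" if "j \<le> M" for j
    using i that by (simp add: word_def)
  have "letter M S1 i = 2" using all[rule_format, of 0] w[of 0] by (simp add: allowed_def)
  then have "i mod Suc M = 0" by (auto simp: letter_def split: if_splits)
  then obtain b where b: "i = b * Suc M" by (metis dvd_def mod_0_imp_dvd mult.commute)
  have bN: "b < N1"
  proof (rule ccontr)
    assume "\<not> b < N1"
    then have "N1 * Suc M \<le> b * Suc M" by (intro mult_le_mono1) simp
    with i b show False by simp
  qed
  have "S1 b j \<or> S2 a j" if "j < M" for j
  proof -
    have j: "Suc j \<le> M" using that by simp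
    note ix = block_index[OF bN j]
    have "allowed S2 a (Suc j) (letter M S1 (b * Suc M + Suc j))"
      using all[rule_format, OF j] w[OF j] b by simp
    then show ?thesis unfolding letter_def ix by (auto simp: allowed_def split: if_splits)
  qed
  with a bN show "\<exists>b < N1. \<exists>a < N2. \<forall>j < M. S1 b j \<or> S2 a j" by blast
next
  let ?w = "word M N1 S1" and ?\<delta> = "trans (automaton M N2 S2)"
  assume "\<exists>b < N1. \<exists>a < N2. \<forall>j < M. S1 b j \<or> S2 a j"
  then obtain a b where a: "a < N2" and b: "b < N1" and sat: "\<forall>j < M. S1 b j \<or> S2 a j" by blast
  \<comment> \<open>\<open>x\<close> is read by the loops at state 0, \<open>y\<close>, the block of
    \<open>b\<close>, by the states for \<open>a\<close>, and \<open>z\<close> by the loops at state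
    1.\<close>
  define x y z where "x = take (b * Suc M) ?w" and "y = take (Suc M) (drop (b * Suc M) ?w)"
    and "z = drop (Suc M) (drop (b * Suc M) ?w)"
  have w: "?w = x @ y @ z" unfolding x_def y_def z_def by (simp only: append_take_drop_id)
  have "set ?w \<subseteq> {..<4}" by (auto simp: word_def letter_def)
  then have xz: "x \<in> lists {..<4}" "z \<in> lists {..<4}" unfolding w by auto
  have "b * Suc M + M < N1 * Suc M" using block_index(1)[OF b order_refl] .
  then have len: "length y = Suc M - 0" unfolding y_def by (auto simp: word_def)
  have "allowed S2 a (0 + i) (y ! i)" if "i < length y" for i
  proof -
    have i: "i \<le> M" using that len by simp
    note ix = block_index[OF b i]
    have "y ! i = letter M S1 (b * Suc M + i)" using that len ix(1) by (simp add: y_def word_def)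
    then show ?thesis using sat i unfolding letter_def ix by (cases i) (auto simp: allowed_def Suc_le_eq)
  qed
  then have "path ?\<delta> (a * Suc M + 0 + 2) y 1" by (intro path_block[OF a _ len]) auto
  then have "path ?\<delta> 0 y 1" using path_eps[OF edge_start[OF a]] by simp
  then have "path ?\<delta> 0 ?w 1"
    unfolding w using xz by (intro path_append[OF path_loops] path_append[OF _ path_loops]) auto
  then show "?w \<in> lang (automaton M N2 S2)" by (simp add: lang_def automaton_def)
qed

section \<open>The reduction\<close>

text \<open>Zero outside the list, as in \<open>init_state\<close>, so that storing at index
  \<open>length ys\<close> amounts to appending.\<close>

definition arr_of :: "nat list \<Rightarrow> nat \<Rightarrow> nat" where
  "arr_of ys = (\<lambda>i. if i < length ys then ys ! i else 0)"

lemma arr_of_snoc: "(arr_of ys)(length ys := v) = arr_of (ys @ [v])"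
  by (auto simp: arr_of_def fun_eq_iff nth_append)

lemma arr_of_le: "\<forall>y \<in> set ys. y \<le> B \<Longrightarrow> arr_of ys i \<le> B"
  by (auto simp: arr_of_def)

lemma eval_upd_other: "a \<notin> arrs e \<Longrightarrow> eval e \<sigma> (M(a := z)) = eval e \<sigma> M"
  by (induction e) auto

lemma fits_upd_other: "a \<notin> arrs e \<Longrightarrow> fits W e \<sigma> (M(a := z)) = fits W e \<sigma> M"
  by (induction e) (auto simp: eval_upd_other)

lemma steps_assign:
  assumes "fits W e \<sigma> M" "eval e \<sigma> M = v"
  shows "steps W (Asg x e) (\<sigma>, M) (1 + cost e) (\<sigma>(x := v), M)"
  using steps_Asg[OF assms(1)] assms(2) by simp

lemma steps_append:
  assumes "fits W i \<sigma> M" "fits W e \<sigma> M" "M a = arr_of ys" "eval i \<sigma> M = length ys" "eval e \<sigma> M = v"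
  shows "steps W (Sto a i e) (\<sigma>, M) (1 + cost i + cost e) (\<sigma>, M(a := arr_of (ys @ [v])))"
  using steps_Sto[OF assms(1,2), of a] unfolding assms(3-5) arr_of_snoc .

text \<open>Neither expression reads the array being filled, so all side conditions can refer to the
  initial memory \<open>M\<close>. The 11 consists of 3 steps for the index sum and the store, and
  the 8 of a loop round.\<close>

lemma steps_fill:
  assumes "M a = arr_of ys" "a \<notin> arrs b" "a \<notin> arrs e"
    and fits: "\<And>i. i < n \<Longrightarrow> fits W (Bin Plus b (Var x)) (\<sigma>(x := i)) M"
      "\<And>i. i < n \<Longrightarrow> fits W e (\<sigma>(x := i)) M"
    and eval: "\<And>i. i < n \<Longrightarrow> eval b (\<sigma>(x := i)) M = length ys"
      "\<And>i. i < n \<Longrightarrow> eval e (\<sigma>(x := i)) M = f i"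
    and "\<sigma> y = n" "x \<noteq> y" "Suc n < W"
  shows "steps W (For x y (Sto a (Bin Plus b (Var x)) e)) (\<sigma>, M)
    (n * (cost b + cost e + 11) + 6) (\<sigma>(x := n), M(a := arr_of (ys @ map f [0..<n])))"
proof -
  let ?M = "\<lambda>i. M(a := arr_of (ys @ map f [0..<i]))"
  have body: "steps W (Sto a (Bin Plus b (Var x)) e) (\<sigma>(x := i), ?M i) (cost b + cost e + 3)
    (\<sigma>(x := i), ?M (Suc i))" if i: "i < n" for i
  proof -
    have "steps W (Sto a (Bin Plus b (Var x)) e) (\<sigma>(x := i), ?M i)
        (1 + cost (Bin Plus b (Var x)) + cost e)
        (\<sigma>(x := i), (?M i)(a := arr_of ((ys @ map f [0..<i]) @ [f i])))"
      using assms(2,3) fits[OF i] eval[OF i]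
      by (intro steps_append) (simp_all add: eval_upd_other fits_upd_other)
    then show ?thesis by (rule steps_weaken) simp_all
  qed
  have M: "?M 0 = M" using assms(1) by auto
  have "steps W (For x y (Sto a (Bin Plus b (Var x)) e)) (\<sigma>, ?M 0)
      (n * ((cost b + cost e + 3) + 8) + 6) (\<sigma>(x := n), ?M n)"
    by (rule steps_For[where \<sigma>' = "\<lambda>i. \<sigma>(x := i)", OF body]) (use assms in auto)
  then show ?thesis unfolding M by (rule steps_weaken) simp_all
qed

definition modE :: "exp \<Rightarrow> exp \<Rightarrow> exp" where
  "modE a b = Bin Minus a (Bin Times (Bin Divide a b) b)"

lemma eval_modE [simp]: "eval (modE a b) \<sigma> M = eval a \<sigma> M mod eval b \<sigma> M"
  by (simp add: modE_def minus_div_mult_eq_mod)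

text \<open>Program variables: 0 number of variables, 1 number of clauses, 2 number of variables in the
  first half, 3 number of blocks of the word, 4 number of block states of the automaton, 5 length of
  a block, 6 length of the word, 7 length of the list of transitions, 8 loop counter, 9 position in
  the input. Arrays: 0 input, 1 output, 2 positions of the clauses in the input, 3 and 4 input and
  output of the embedded program.\<close>

definition lit_sat :: "nat \<Rightarrow> bool \<Rightarrow> nat \<Rightarrow> nat \<Rightarrow> bool" where
  "lit_sat h side x l \<longleftrightarrow> (if l div 2 < h then side \<and> even (Bit_Operations.xor (drop_bit (l div 2) x) l)
     else \<not> side \<and> even (Bit_Operations.xor (drop_bit (l div 2 - h) x) l))"

text \<open>The low bit of \<open>l\<close> is the sign of the literal, so its xor with the shifted
  assignment is even exactly if the literal holds. The truncated difference
  \<open>Bin Minus (Var 2) v\<close> tests whether \<open>v\<close> lies in the first half.\<close>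

definition litE :: "bool \<Rightarrow> exp \<Rightarrow> exp \<Rightarrow> exp" where
  "litE side x l = (let v = Bin Divide l (Num 2);
      test = (\<lambda>s. Ite (Bin And (Bin Xor (Bin ShiftR x s) l) (Num 1)) (Num 0) (Num 1)) in
    Ite (Bin Minus (Var 2) v) (if side then test v else Num 0)
      (if side then Num 0 else test (Bin Minus v (Var 2))))"

lemma eval_litE:
  "eval (litE side x l) \<sigma> M = of_bool (lit_sat (\<sigma> 2) side (eval x \<sigma> M) (eval l \<sigma> M))"
  by (auto simp: litE_def lit_sat_def Let_def and_one_eq even_iff_mod_2_eq_zero)

text \<open>The loop over the literals of a clause is unrolled, so the cost depends on
  \<open>k\<close> only. The cell that array 2 points to holds the clause length; hence literal
  \<open>q\<close> sits \<open>Suc q\<close> cells further, and it is consulted only if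
  \<open>q\<close> is below that length.\<close>

fun satE :: "bool \<Rightarrow> nat \<Rightarrow> exp \<Rightarrow> exp \<Rightarrow> exp" where
  "satE side 0 x j = Num 0"
| "satE side (Suc q) x j = Ite (Ite (Bin Minus (Arr 0 (Arr 2 j)) (Num q))
     (litE side x (Arr 0 (Bin Plus (Arr 2 j) (Num (Suc q))))) (Num 0)) (Num 1) (satE side q x j)"

lemma eval_satE:
  "eval (satE side k x j) \<sigma> M = of_bool (\<exists>q < k. q < M 0 (M 2 (eval j \<sigma> M)) \<and>
     lit_sat (\<sigma> 2) side (eval x \<sigma> M) (M 0 (M 2 (eval j \<sigma> M) + Suc q)))"
  by (induction k) (auto simp: eval_litE less_Suc_eq)

definition wordE :: "nat \<Rightarrow> exp" where
  "wordE k = (let j = modE (Var 8) (Var 5) in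
     Ite j (Ite (satE True k (Bin Divide (Var 8) (Var 5)) (Bin Minus j (Num 1))) (Num 0) (Num 1)) (Num 2))"

text \<open>\<open>triple\<close> selects one of the three entries of a transition. Since
  \<open>enc_trans\<close> reserves 0 for the empty label, letters appear increased by one: in the
  labels of a block, 1, 2, 3, 4 stand for the letters 0, 1, 2, 3.\<close>

definition transE :: "nat \<Rightarrow> exp" where
  "transE k = (let t = Bin Divide (Var 8) (Num 3); i = modE (Var 8) (Num 3);
     triple = (\<lambda>a b c. Ite i (Ite (Bin Minus i (Num 1)) c b) a);
     r = modE t (Num 2); g = Bin Divide t (Num 2); j = modE g (Var 5);
     block = triple (Bin Plus g (Num 2))
       (Ite j (Ite r (Ite (satE False k (Bin Divide g (Var 5)) (Bin Minus j (Num 1))) (Num 2) (Num 4)) (Num 1)) (Num 3))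
       (Ite (Bin Minus (Var 1) j) (Bin Plus g (Num 3)) (Num 1));
     c = Bin Minus g (Var 4); q = Bin Divide c (Num 2)
   in Ite (Bin Minus (Var 4) g)
     (Ite j block (Ite r (triple (Num 0) (Num 0) (Bin Plus g (Num 2))) block))
     (triple q (Bin Plus (Bin Plus (Bin Times (Num 2) (modE c (Num 2))) r) (Num 1)) q))"

definition bounded :: "nat \<Rightarrow> (nat \<Rightarrow> nat) \<Rightarrow> (arr \<Rightarrow> nat \<Rightarrow> nat) \<Rightarrow> bool" where
  "bounded B \<sigma> M \<longleftrightarrow> (\<forall>x. \<sigma> x \<le> B) \<and> (\<forall>i. M 0 i \<le> B) \<and> (\<forall>i. M 2 i \<le> B)"

text \<open>A syntactic test that lets the entry expressions fit into a word without looking at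
  their values. The 6 is the length of the header, the largest constant apart from those of the
  unrolled clause, which are at most \<open>k\<close>.\<close>

definition simple :: "nat \<Rightarrow> exp \<Rightarrow> bool" where
  "simple k e \<longleftrightarrow> no_shift e \<and> nums e \<subseteq> {..6 + k} \<and> arrs e \<subseteq> {0, 2}"

lemma simple_simps [simp]:
  "simple k (Num n) \<longleftrightarrow> n \<le> 6 + k"
  "simple k (Var x)"
  "simple k (Bin p e1 e2) \<longleftrightarrow> p \<noteq> ShiftL \<and> simple k e1 \<and> simple k e2"
  "simple k (Arr a e) \<longleftrightarrow> a \<in> {0, 2} \<and> simple k e"
  "simple k (Ite e e1 e2) \<longleftrightarrow> simple k e \<and> simple k e1 \<and> simple k e2"
  by (auto simp: simple_def)

lemma simple_modE [simp]: "simple k (modE a b) \<longleftrightarrow> simple k a \<and> simple k b"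
  by (auto simp: modE_def)

lemma simple_litE: "simple k x \<Longrightarrow> simple k l \<Longrightarrow> simple k (litE side x l)"
  by (simp add: litE_def Let_def)

lemma simple_satE: "q \<le> k \<Longrightarrow> simple k x \<Longrightarrow> simple k j \<Longrightarrow> simple k (satE side q x j)"
  by (induction q) (simp_all add: simple_litE)

lemma simple_wordE: "simple k (wordE k)"
  by (simp add: wordE_def Let_def simple_satE)

lemma simple_transE: "simple k (transE k)"
  by (simp add: transE_def Let_def simple_satE)

lemma fits_simple:
  assumes "simple k e" "bounded B \<sigma> M" "6 + k \<le> B" "B ^ K < W" "cost e \<le> K"
  shows "fits W e \<sigma> M"
proof (rule fits_if_bounded(2)[where B = B])
  have "B ^ cost e \<le> B ^ K" using assms(3,5) by (intro power_increasing) simp_all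
  then show "B ^ cost e < W" using assms(4) by simp
qed (use assms in \<open>auto simp: simple_def bounded_def subset_iff\<close>)

text \<open>Left shifts occur only here, to compute powers of two; their values are bounded directly
  and not through \<open>simple\<close>. Variable 4 first holds the number of assignments of the
  second half and is then multiplied by the block length. Variable 7 counts three entries per
  transition.\<close>

definition initialize :: com where
  "initialize =
     Seq (Asg 0 (Arr 0 (Num 0)))
    (Seq (Asg 1 (Arr 0 (Num 1)))
    (Seq (Asg 2 (Bin Divide (Var 0) (Num 2)))
    (Seq (Asg 3 (Bin ShiftL (Num 1) (Var 2)))
    (Seq (Asg 4 (Bin ShiftL (Num 1) (Bin Minus (Var 0) (Var 2))))
    (Seq (Asg 5 (Bin Plus (Var 1) (Num 1)))
    (Seq (Asg 4 (Bin Times (Var 4) (Var 5)))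
    (Seq (Asg 6 (Bin Times (Var 3) (Var 5)))
    (Seq (Asg 7 (Bin Times (Num 6) (Bin Plus (Var 4) (Num 4))))
         (Asg 9 (Num 2))))))))))"

text \<open>Clauses differ in length, so their positions are tabulated; afterwards testing a given
  clause takes constant time for fixed \<open>k\<close>.\<close>

definition locate_clauses :: com where
  "locate_clauses = For 8 1 (Seq (Sto 2 (Var 8) (Var 9))
     (Asg 9 (Bin Plus (Var 9) (Bin Plus (Num 1) (Arr 0 (Var 9))))))"

definition write_header :: com where
  "write_header =
     Seq (Sto 3 (Num 0) (Var 6))
    (Seq (Sto 3 (Num 1) (Bin Times (Num 2) (Bin Plus (Var 4) (Num 4))))
    (Seq (Sto 3 (Num 2) (Bin Plus (Var 4) (Num 2)))
    (Seq (Sto 3 (Num 3) (Num 4))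
    (Seq (Sto 3 (Num 4) (Num 0))
         (Sto 3 (Num 5) (Num 1))))))"

definition prepare :: "nat \<Rightarrow> com" where
  "prepare k = Seq initialize (Seq locate_clauses (Seq write_header
     (Seq (For 8 6 (Sto 3 (Bin Plus (Num 6) (Var 8)) (wordE k)))
          (For 8 7 (Sto 3 (Bin Plus (Bin Plus (Num 6) (Var 6)) (Var 8)) (transE k))))))"

text \<open>Serves both as time per written entry and as exponent of the word size; the 20 is slack
  for loop overhead and index computations.\<close>

definition max_cost :: "nat \<Rightarrow> nat" where
  "max_cost k = 20 + cost (wordE k) + cost (transE k)"

definition half_sat :: "literal list list \<Rightarrow> nat \<Rightarrow> bool \<Rightarrow> nat \<Rightarrow> nat \<Rightarrow> bool" where
  "half_sat css h side x j \<longleftrightarrow> (\<exists>l \<in> set (css ! j). lit_sat h side x (enc_literal l))"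

definition clause_code :: "literal list \<Rightarrow> nat list" where
  "clause_code cs = length cs # map enc_literal cs"

definition formula_code :: "nat \<Rightarrow> literal list list \<Rightarrow> nat list" where
  "formula_code n css = [n, length css] @ concat (map clause_code css)"

definition offset :: "literal list list \<Rightarrow> nat \<Rightarrow> nat" where
  "offset css j = 2 + length (concat (map clause_code (take j css)))"

lemma offset_Suc: "j < length css \<Longrightarrow> offset css (Suc j) = offset css j + (1 + length (css ! j))"
  by (simp add: offset_def take_Suc_conv_app_nth clause_code_def)

lemma formula_code_nth:
  assumes "j < length css"
  shows "arr_of (formula_code n css) (offset css j) = length (css ! j)"
    and "q < length (css ! j) \<Longrightarrow>
      arr_of (formula_code n css) (offset css j + Suc q) = enc_literal (css ! j ! q)"
    and "offset css j + length (css ! j) < length (formula_code n css)"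
proof -
  define A where "A = [n, length css] @ concat (map clause_code (take j css))"
  have A: "length A = offset css j" by (simp add: A_def offset_def)
  have "css = take j css @ css ! j # drop (Suc j) css" using assms by (rule id_take_nth_drop)
  then have "concat (map clause_code css) = concat (map clause_code (take j css)) @
      clause_code (css ! j) @ concat (map clause_code (drop (Suc j) css))"
    by (metis concat.simps(2) concat_append list.simps(9) map_append)
  then have f: "formula_code n css =
      A @ clause_code (css ! j) @ concat (map clause_code (drop (Suc j) css))"
    by (simp add: A_def formula_code_def)
  show "arr_of (formula_code n css) (offset css j) = length (css ! j)"
    "q < length (css ! j) \<Longrightarrow>
      arr_of (formula_code n css) (offset css j + Suc q) = enc_literal (css ! j ! q)"
    "offset css j + length (css ! j) < length (formula_code n css)"
    unfolding f A[symmetric] arr_of_def by (auto simp: nth_append clause_code_def)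
qed

text \<open>Gives random access to the flattened list, which the program fills with the entry index
  as its only loop state.\<close>

lemma concat_map_triples:
  assumes "\<And>t. length (f t) = 3"
  shows "concat (map f [0..<m]) = map (\<lambda>i. f (i div 3) ! (i mod 3)) [0..<3 * m]"
proof (induction m)
  case (Suc m)
  have "[0..<3 * Suc m] = [0..<3 * m] @ [3 * m, 3 * m + 1, 3 * m + 2]"
  proof -
    have "[x..<x + 3] = [x, x + 1, x + 2]" for x :: nat
      by (simp add: upt_conv_Cons eval_nat_numeral One_nat_def)
    moreover have "[0..<3 * Suc m] = [0..<3 * m] @ [3 * m..<3 * m + 3]"
      using upt_add_eq_append[of 0 "3 * m" 3] by (simp add: add.commute)
    ultimately show ?thesis by simp
  qed
  moreover have "f m = [f m ! 0, f m ! 1, f m ! 2]"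
    using assms[of m] by (auto simp: numeral_3_eq_3 numeral_2_eq_2 One_nat_def length_Suc_conv)
  moreover have "(3 * m + 1) div 3 = m" "(3 * m + 2) div 3 = m" "(3 * m + 1) mod 3 = 1" "(3 * m + 2) mod 3 = 2"
    by presburger+
  ultimately show ?case using Suc by simp
qed simp

lemma lit_sat_literal:
  "lit_sat h True x (enc_literal (v, b)) \<longleftrightarrow> v < h \<and> bit x v = b"
  "lit_sat h False x (enc_literal (v, b)) \<longleftrightarrow> h \<le> v \<and> bit x (v - h) = b"
  by (auto simp: lit_sat_def enc_literal_def even_xor_iff even_drop_bit_iff_not_bit)

lemma ex_bits: "\<exists>x < 2 ^ l. \<forall>v < l. bit (x :: nat) v = \<alpha> v"
  by (rule exI[of _ "horner_sum of_bool 2 (map \<alpha> [0..<l])"])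
     (use horner_sum_of_bool_2_less[of "map \<alpha> [0..<l]"] in \<open>auto simp: bit_horner_sum_bit_iff\<close>)

section \<open>Correctness of the reduction for a fixed formula\<close>

locale kcnf =
  fixes k n :: nat and css :: "literal list list"
  assumes clause_length: "cs \<in> set css \<Longrightarrow> length cs \<le> k"
    and clause_vars: "cs \<in> set css \<Longrightarrow> (v, b) \<in> set cs \<Longrightarrow> v < n"
begin

definition "M = length css"
definition "h = n div 2"
definition "left_sat = half_sat css h True"
definition "right_sat = half_sat css h False"
definition "G = 2 ^ (n - h) * Suc M"
text \<open>A common bound for variables, input cells and clause positions. Order
  \<open>2 ^ n * Suc M\<close> is affordable: word values may be polynomial in the time bound, which
  is itself exponential in \<open>n\<close>.\<close>

definition "B = 6 * (2 ^ n * Suc M + 4) + length (formula_code n css) + k"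

text \<open>The store once the clause table is complete, apart from loop counter 8: variable 9 then
  points behind the last clause. Earlier phases override 9.\<close>

definition \<sigma>0 :: "nat \<Rightarrow> nat" where
  "\<sigma>0 = (\<lambda>_. 0)(0 := n, 1 := M, 2 := h, 3 := 2 ^ h, 5 := Suc M, 4 := G, 6 := 2 ^ h * Suc M,
     7 := 6 * (G + 4), 9 := offset css M)"

definition instance_code :: "nat list" where
  "instance_code = [2 ^ h * Suc M, 2 * (G + 4), G + 2, 4, 0, 1] @ word M (2 ^ h) left_sat @
     concat (map enc_trans (map (edge M (2 ^ (n - h)) right_sat) [0..<2 * (G + 4)]))"

lemma half_powers: "(2::nat) ^ h * 2 ^ (n - h) = 2 ^ n" "h \<le> n"
  by (simp_all add: h_def flip: power_add)

lemma bounds: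
  "6 + k \<le> B" "n \<le> B" "M \<le> B" "h \<le> B" "2 ^ h \<le> B" "2 ^ (n - h) \<le> B" "Suc M \<le> B" "G \<le> B"
  "2 ^ h * Suc M \<le> B" "6 * (G + 4) \<le> B" "length (formula_code n css) \<le> B"
proof -
  have le: "(2::nat) ^ h \<le> 2 ^ n" "(2::nat) ^ (n - h) \<le> 2 ^ n"
    using half_powers(2) by (simp_all add: power_increasing)
  then have 1: "2 ^ h * Suc M \<le> 2 ^ n * Suc M" "G \<le> 2 ^ n * Suc M"
    unfolding G_def by (intro mult_le_mono1; simp)+
  have 2: "n < 2 ^ n" by (rule less_exp)
  have 3: "2 ^ n * 1 \<le> 2 ^ n * Suc M" "1 * Suc M \<le> 2 ^ n * Suc M"
    by (intro mult_le_mono; simp)+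
  define X Y where "X = 2 ^ n * Suc M" and "Y = 2 ^ h * Suc M"
  have B: "B = 6 * (X + 4) + length (formula_code n css) + k" by (simp only: B_def X_def)
  have X: "Y \<le> X" "G \<le> X" "2 ^ n \<le> X" "Suc M \<le> X"
    using 1[folded X_def Y_def] 3[folded X_def] by simp_all
  then have "2 ^ h \<le> X" "2 ^ (n - h) \<le> X" "n \<le> X" "h \<le> X"
    using 2 le half_powers(2) by linarith+
  note defs = this X B
  show "6 + k \<le> B" "length (formula_code n css) \<le> B" unfolding B_def by simp_all
  show "n \<le> B" "h \<le> B" "2 ^ h \<le> B" "2 ^ (n - h) \<le> B" "Suc M \<le> B" "G \<le> B" "2 ^ h * Suc M \<le> B"
    "6 * (G + 4) \<le> B"
    unfolding Y_def[symmetric] using defs by auto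
  then show "M \<le> B" by simp
qed

lemma code_le: "\<forall>y \<in> set (formula_code n css). y \<le> B"
proof -
  have "enc_literal l \<le> B" if "cs \<in> set css" "l \<in> set cs" for cs l
  proof -
    have "fst l < n" using clause_vars[OF that(1), of "fst l" "snd l"] that(2) by simp
    then have "enc_literal l \<le> 2 * n" by (auto simp: enc_literal_def split: prod.splits)
    also have "2 * n \<le> 6 * (2 ^ n * Suc M + 4)"
    proof -
      have "n < 2 ^ n" by (rule less_exp)
      also have "2 ^ n * 1 \<le> 2 ^ n * Suc M" by (intro mult_le_mono) simp_all
      finally show ?thesis by simp
    qed
    finally show ?thesis unfolding B_def by simp
  qed
  moreover have "length cs \<le> B" if "cs \<in> set css" for cs
    using clause_length[OF that] bounds(1) by simp
  ultimately show ?thesis using bounds(2,3) by (auto simp: formula_code_def clause_code_def M_def)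
qed

lemma offset_le: "j \<le> M \<Longrightarrow> offset css j \<le> B"
proof -
  assume "j \<le> M"
  have "length (concat (map clause_code css)) =
      length (concat (map clause_code (take j css))) + length (concat (map clause_code (drop j css)))"
    by (metis append_take_drop_id concat_append length_append map_append)
  then have "offset css j \<le> length (formula_code n css)"
    by (simp add: offset_def formula_code_def)
  then show ?thesis using bounds(11) by simp
qed

lemma bounded_\<sigma>0: "\<sigma>0 x \<le> B"
  using bounds offset_le[of M] unfolding \<sigma>0_def by simp

lemma boundedI:
  assumes "\<forall>x. \<sigma> x \<le> B" "M' 0 = arr_of (formula_code n css)"
    "M' 2 = arr_of (map (offset css) [0..<j])" "j \<le> M"
  shows "bounded B \<sigma> M'"
  using assms code_le offset_le by (auto simp: bounded_def intro!: arr_of_le)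

text \<open>A clause has at most \<open>k\<close> literals, so the \<open>k\<close>-fold unrolled
  test misses none of them.\<close>

lemma half_sat_code:
  assumes "j < M" "M' 0 = arr_of (formula_code n css)" "M' 2 = arr_of (map (offset css) [0..<M])"
    "\<sigma> 2 = h" "eval e \<sigma> M' = j"
  shows "eval (satE side k x e) \<sigma> M' = of_bool (half_sat css h side (eval x \<sigma> M') j)"
proof -
  have j: "j < length css" using assms(1) by (simp add: M_def)
  have off: "M' 2 j = offset css j" using assms by (simp add: arr_of_def)
  let ?P = "\<lambda>l. lit_sat h side (eval x \<sigma> M') l" and ?L = "length (css ! j)"
  have "?L \<le> k" using j by (intro clause_length) simp
  then have "(\<exists>q < k. q < M' 0 (offset css j) \<and> ?P (M' 0 (offset css j + Suc q))) \<longleftrightarrow>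
      (\<exists>q < ?L. ?P (enc_literal (css ! j ! q)))"
    unfolding assms(2) formula_code_nth(1)[OF j]
    using formula_code_nth(2)[OF j] by (metis order_less_le_trans)
  also have "\<dots> \<longleftrightarrow> half_sat css h side (eval x \<sigma> M') j"
    unfolding half_sat_def by (metis in_set_conv_nth)
  finally show ?thesis unfolding eval_satE assms(4,5) off by simp
qed

lemma eval_wordE:
  assumes "i < 2 ^ h * Suc M" "M' 0 = arr_of (formula_code n css)"
    "M' 2 = arr_of (map (offset css) [0..<M])" "\<sigma> = \<sigma>0(8 := i)"
  shows "eval (wordE k) \<sigma> M' = letter M left_sat i"
proof -
  have \<sigma>: "\<sigma> 2 = h" "\<sigma> 5 = Suc M" "\<sigma> 8 = i" by (simp_all add: assms(4) \<sigma>0_def)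
  show ?thesis
  proof (cases "i mod Suc M = 0")
    case True
    then show ?thesis by (simp add: wordE_def Let_def \<sigma> letter_def)
  next
    case False
    have "i mod Suc M < Suc M" by simp
    with False have j: "i mod Suc M - 1 < M" by linarith
    show ?thesis using False half_sat_code[where \<sigma> = \<sigma>, OF j assms(2,3)] \<sigma>
      by (simp add: wordE_def Let_def letter_def left_sat_def)
  qed
qed

lemma eval_transE:
  assumes "i < 6 * (G + 4)" "M' 0 = arr_of (formula_code n css)"
    "M' 2 = arr_of (map (offset css) [0..<M])" "\<sigma> = \<sigma>0(8 := i)"
  shows "eval (transE k) \<sigma> M' = enc_trans (edge M (2 ^ (n - h)) right_sat (i div 3)) ! (i mod 3)"
proof -
  have \<sigma>: "\<sigma> 1 = M" "\<sigma> 2 = h" "\<sigma> 4 = G" "\<sigma> 5 = Suc M" "\<sigma> 8 = i"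
    by (simp_all add: assms(4) \<sigma>0_def)
  define g j where "g = i div 3 div 2" and "j = g mod Suc M"
  have i3: "i mod 3 = 0 \<or> i mod 3 = 1 \<or> i mod 3 = 2" by linarith
  have r: "i div 3 mod 2 = 0 \<or> i div 3 mod 2 = 1" by linarith
  have "j < Suc M" by (simp add: j_def)
  then have jM: "(M - j = 0) = (j = M)" and j: "j \<noteq> 0 \<Longrightarrow> j - 1 < M" by linarith+
  have sat: "eval (satE False k x e) \<sigma> M' = of_bool (right_sat (eval x \<sigma> M') (j - 1))"
    if "j \<noteq> 0" "eval e \<sigma> M' = j - 1" for x e
    unfolding right_sat_def by (rule half_sat_code[OF j[OF that(1)] assms(2,3) \<sigma>(2) that(2)])
  show ?thesis
  proof (cases "g < G")
    case True
    then have "G - g \<noteq> 0" by simp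
    with True i3 r jM sat show ?thesis
      unfolding edge_def Let_def transE_def G_def[symmetric] g_def[symmetric] j_def[symmetric]
      by (cases "j = 0"; elim disjE;
          simp add: \<sigma> flip: g_def j_def)
  next
    case False
    then have "G - g = 0" by simp
    with False i3 r show ?thesis
      unfolding edge_def Let_def transE_def G_def[symmetric] g_def[symmetric] j_def[symmetric]
      by (elim disjE; simp add: \<sigma> flip: g_def j_def)
  qed
qed


abbreviation mem0 :: "arr \<Rightarrow> nat \<Rightarrow> nat" where
  "mem0 \<equiv> (\<lambda>_. arr_of [])(0 := arr_of (formula_code n css))"

abbreviation mem1 :: "arr \<Rightarrow> nat \<Rightarrow> nat" where
  "mem1 \<equiv> mem0(2 := arr_of (map (offset css) [0..<M]))"

lemma max_cost_bounds: "Suc B < B ^ max_cost k" "B \<le> B ^ max_cost k"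
proof -
  have "B \<ge> 6" using bounds(1) by simp
  then have "Suc B < B * B" using mult_le_mono1[of 6 B B] by linarith
  also have "B * B = B ^ 2" by (simp add: power2_eq_square)
  also have "\<dots> \<le> B ^ max_cost k" using \<open>B \<ge> 6\<close> by (intro power_increasing) (simp_all add: max_cost_def)
  finally show "Suc B < B ^ max_cost k" .
  then show "B \<le> B ^ max_cost k" by simp
qed

definition prepare_time :: nat where
  "prepare_time = 200 + M * 20 + (2 ^ h * Suc M + 6 * (G + 4)) * max_cost k"

section \<open>Execution of the preparation with sufficiently large words\<close>

context
  fixes W
  assumes W: "B ^ max_cost k < W"
begin

lemma lt_W: "x \<le> Suc B \<Longrightarrow> x < W"
  using W max_cost_bounds by linarith

lemma steps_initialize: "steps W initialize (\<lambda>_. 0, mem0) 60 (\<sigma>0(9 := 2), mem0)"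
proof -
  have a: "arr_of (formula_code n css) 0 = n" "arr_of (formula_code n css) 1 = M"
    by (simp_all add: arr_of_def formula_code_def M_def)
  have G: "2 ^ (n - h) * Suc M = G" by (simp add: G_def)
  have "0 \<le> Suc B" "1 \<le> Suc B" "2 \<le> Suc B" "4 \<le> Suc B" "6 \<le> Suc B" "n - h \<le> Suc B" "G + 4 \<le> Suc B"
    using bounds by simp_all
  note lt = this[THEN lt_W] bounds[THEN le_SucI, THEN lt_W]
  show ?thesis
    unfolding initialize_def
    by (rule steps_weaken, rule steps_Seq[OF steps_assign[where v = n]
        steps_Seq[OF steps_assign[where v = M]
        steps_Seq[OF steps_assign[where v = h]
        steps_Seq[OF steps_assign[where v = "2 ^ h"]
        steps_Seq[OF steps_assign[where v = "2 ^ (n - h)"]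
        steps_Seq[OF steps_assign[where v = "Suc M"]
        steps_Seq[OF steps_assign[where v = G]
        steps_Seq[OF steps_assign[where v = "2 ^ h * Suc M"]
        steps_Seq[OF steps_assign[where v = "6 * (G + 4)"] steps_assign[where v = 2]]]]]]]]]])
      (use lt in \<open>simp_all add: a G push_bit_eq_mult h_def[symmetric] \<sigma>0_def fun_eq_iff del: mult_Suc_right\<close>)
qed

lemma steps_locate_clauses:
  "steps W locate_clauses (\<sigma>0(9 := 2), mem0) (M * 20 + 6) (\<sigma>0(8 := M), mem1)"
proof -
  let ?\<sigma> = "\<lambda>i. \<sigma>0(9 := offset css i, 8 := i)" and ?M = "\<lambda>i. mem0(2 := arr_of (map (offset css) [0..<i]))"
  have body: "steps W (Seq (Sto 2 (Var 8) (Var 9))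
      (Asg 9 (Bin Plus (Var 9) (Bin Plus (Num 1) (Arr 0 (Var 9))))))
      (?\<sigma> i, ?M i) 12 ((?\<sigma> i)(9 := offset css (Suc i)), ?M (Suc i))" if i: "i < M" for i
  proof -
    have il: "i < length css" using i by (simp add: M_def)
    have o: "offset css i \<le> B" "offset css (Suc i) \<le> B" using offset_le i by simp_all
    have c: "arr_of (formula_code n css) (offset css i) = length (css ! i)"
      by (rule formula_code_nth(1)[OF il])
    have iB: "i \<le> B" using i bounds(3) by simp
    note lt = o[THEN le_SucI, THEN lt_W] iB[THEN le_SucI, THEN lt_W]
    have "length (css ! i) < W" "1 + length (css ! i) < W" "1 < W"
      using o offset_Suc[OF il] bounds(1) by (auto intro!: lt_W)
    note lt = this lt
    have 1: "steps W (Sto 2 (Var 8) (Var 9)) (?\<sigma> i, ?M i) (1 + 1 + 1)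
        (?\<sigma> i, (?M i)(2 := arr_of (map (offset css) [0..<i] @ [offset css i])))"
      using steps_append[where W = W and \<sigma> = "?\<sigma> i" and M = "?M i" and i = "Var 8" and e = "Var 9"
          and a = 2 and ys = "map (offset css) [0..<i]" and v = "offset css i"] lt by simp
    have 2: "steps W (Asg 9 (Bin Plus (Var 9) (Bin Plus (Num 1) (Arr 0 (Var 9))))) (?\<sigma> i, ?M (Suc i))
        (1 + cost (Bin Plus (Var 9) (Bin Plus (Num 1) (Arr 0 (Var 9)))))
        ((?\<sigma> i)(9 := offset css (Suc i)), ?M (Suc i))"
      by (rule steps_assign) (use lt c offset_Suc[OF il] in simp_all)
    have eq: "(?M i)(2 := arr_of (map (offset css) [0..<i] @ [offset css i])) = ?M (Suc i)"
      by simp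
    show ?thesis using steps_Seq[OF 1[unfolded eq] 2] by (rule steps_weaken) simp_all
  qed
  have "Suc M < W" using bounds(7) by (intro lt_W) simp
  then have "steps W locate_clauses (\<sigma>0(9 := 2), ?M 0) (M * (12 + 8) + 6) (?\<sigma> M, ?M M)"
    unfolding locate_clauses_def
    by (intro steps_For[where \<sigma>' = "\<lambda>i. (?\<sigma> i)(9 := offset css (Suc i))", OF body])
       (auto simp: fun_upd_twist offset_def \<sigma>0_def fun_eq_iff)
  moreover have "?M 0 = mem0" by auto
  moreover have "?\<sigma> M = \<sigma>0(8 := M)" by (auto simp: \<sigma>0_def)
  ultimately show ?thesis by simp
qed

lemma steps_write_header:
  "steps W write_header (\<sigma>0(8 := M), mem1) 40
     (\<sigma>0(8 := M), mem1(3 := arr_of [2 ^ h * Suc M, 2 * (G + 4), G + 2, 4, 0, 1]))"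
proof -
  have "0 \<le> Suc B" "1 \<le> Suc B" "2 \<le> Suc B" "3 \<le> Suc B" "4 \<le> Suc B" "5 \<le> Suc B" "6 \<le> Suc B"
    "G + 4 \<le> Suc B" "G + 2 \<le> Suc B" "2 * (G + 4) \<le> Suc B"
    using bounds by simp_all
  note lt = this[THEN lt_W] bounds[THEN le_SucI, THEN lt_W]
  note app = steps_append[where a = 3]
  show ?thesis
    unfolding write_header_def
    by (rule steps_weaken, rule steps_Seq[OF app[where ys = "[]" and v = "2 ^ h * Suc M"]
        steps_Seq[OF app[where ys = "[2 ^ h * Suc M]" and v = "2 * (G + 4)"]
        steps_Seq[OF app[where ys = "[2 ^ h * Suc M, 2 * (G + 4)]" and v = "G + 2"]
        steps_Seq[OF app[where ys = "[2 ^ h * Suc M, 2 * (G + 4), G + 2]" and v = 4]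
        steps_Seq[OF app[where ys = "[2 ^ h * Suc M, 2 * (G + 4), G + 2, 4]" and v = 0]
        app[where ys = "[2 ^ h * Suc M, 2 * (G + 4), G + 2, 4, 0]" and v = 1]]]]]])
      (use lt in \<open>simp_all add: \<sigma>0_def del: mult_Suc_right\<close>)
qed

lemma steps_word:
  "steps W (For 8 6 (Sto 3 (Bin Plus (Num 6) (Var 8)) (wordE k)))
     (\<sigma>0(8 := M), mem1(3 := arr_of [2 ^ h * Suc M, 2 * (G + 4), G + 2, 4, 0, 1]))
     (2 ^ h * Suc M * max_cost k + 6)
     (\<sigma>0(8 := 2 ^ h * Suc M),
      mem1(3 := arr_of ([2 ^ h * Suc M, 2 * (G + 4), G + 2, 4, 0, 1] @ word M (2 ^ h) left_sat)))"
proof -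
  let ?n = "2 ^ h * Suc M" and ?ys = "[2 ^ h * Suc M, 2 * (G + 4), G + 2, 4, 0, 1]"
  let ?M = "mem1(3 := arr_of ?ys)"
  have bd: "bounded B ((\<sigma>0(8 := M))(8 := i)) ?M" if "i < ?n" for i
    using bounds(9) that bounded_\<sigma>0 by (intro boundedI[where j = M]) (auto simp del: mult_Suc_right)
  have K: "cost (wordE k) \<le> max_cost k" "3 \<le> max_cost k" by (simp_all add: max_cost_def)
  have "steps W (For 8 6 (Sto 3 (Bin Plus (Num 6) (Var 8)) (wordE k))) (\<sigma>0(8 := M), ?M)
      (?n * (cost (Num 6) + cost (wordE k) + 11) + 6)
      ((\<sigma>0(8 := M))(8 := ?n), ?M(3 := arr_of (?ys @ map (letter M left_sat) [0..<?n])))"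
  proof (rule steps_fill)
    show "3 \<notin> arrs (wordE k)" using simple_wordE[of k] by (auto simp: simple_def)
    fix i assume i: "i < ?n"
    show "fits W (Bin Plus (Num 6) (Var 8)) ((\<sigma>0(8 := M))(8 := i)) ?M"
      by (rule fits_simple[OF _ bd[OF i] bounds(1) W]) (use K in simp_all)
    show "fits W (wordE k) ((\<sigma>0(8 := M))(8 := i)) ?M"
      by (rule fits_simple[OF simple_wordE bd[OF i] bounds(1) W K(1)])
    show "eval (wordE k) ((\<sigma>0(8 := M))(8 := i)) ?M = letter M left_sat i"
      by (rule eval_wordE[OF i]) simp_all
  qed (use bounds(9) in \<open>auto simp: \<sigma>0_def intro!: lt_W simp del: mult_Suc_right\<close>)
  then show ?thesis
    by (rule steps_weaken) (auto simp: word_def max_cost_def simp del: mult_Suc_right)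
qed

lemma steps_trans:
  "steps W (For 8 7 (Sto 3 (Bin Plus (Bin Plus (Num 6) (Var 6)) (Var 8)) (transE k)))
     (\<sigma>0(8 := 2 ^ h * Suc M),
      mem1(3 := arr_of ([2 ^ h * Suc M, 2 * (G + 4), G + 2, 4, 0, 1] @ word M (2 ^ h) left_sat)))
     (6 * (G + 4) * max_cost k + 6) (\<sigma>0(8 := 6 * (G + 4)), mem1(3 := arr_of instance_code))"
proof -
  let ?n = "6 * (G + 4)" and ?\<sigma> = "\<sigma>0(8 := 2 ^ h * Suc M)"
  let ?ys = "[2 ^ h * Suc M, 2 * (G + 4), G + 2, 4, 0, 1] @ word M (2 ^ h) left_sat"
  let ?M = "mem1(3 := arr_of ?ys)" and ?f = "\<lambda>i. enc_trans (edge M (2 ^ (n - h)) right_sat (i div 3)) ! (i mod 3)"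
  have bd: "bounded B (?\<sigma>(8 := i)) ?M" if "i < ?n" for i
    using bounds(10) that bounded_\<sigma>0 by (intro boundedI[where j = M]) auto
  have K: "cost (transE k) \<le> max_cost k" "5 \<le> max_cost k" by (simp_all add: max_cost_def)
  have "steps W (For 8 7 (Sto 3 (Bin Plus (Bin Plus (Num 6) (Var 6)) (Var 8)) (transE k))) (?\<sigma>, ?M)
      (?n * (cost (Bin Plus (Num 6) (Var 6)) + cost (transE k) + 11) + 6)
      (?\<sigma>(8 := ?n), ?M(3 := arr_of (?ys @ map ?f [0..<?n])))"
  proof (rule steps_fill)
    show "3 \<notin> arrs (transE k)" using simple_transE[of k] by (auto simp: simple_def)
    fix i assume i: "i < ?n"
    show "fits W (Bin Plus (Bin Plus (Num 6) (Var 6)) (Var 8)) (?\<sigma>(8 := i)) ?M"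
      by (rule fits_simple[OF _ bd[OF i] bounds(1) W]) (use K in simp_all)
    show "fits W (transE k) (?\<sigma>(8 := i)) ?M"
      by (rule fits_simple[OF simple_transE bd[OF i] bounds(1) W K(1)])
    show "eval (transE k) (?\<sigma>(8 := i)) ?M = ?f i"
      by (rule eval_transE[OF i]) simp_all
    show "eval (Bin Plus (Num 6) (Var 6)) (?\<sigma>(8 := i)) ?M = length ?ys"
      by (simp add: \<sigma>0_def word_def)
  qed (use bounds(10) in \<open>auto simp: \<sigma>0_def intro!: lt_W\<close>)
  moreover have "length (enc_trans (edge M (2 ^ (n - h)) right_sat t)) = 3" for t
    by (cases "edge M (2 ^ (n - h)) right_sat t" rule: enc_trans.cases) simp_all
  then have "concat (map enc_trans (map (edge M (2 ^ (n - h)) right_sat) [0..<2 * (G + 4)])) =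
      map ?f [0..<3 * (2 * (G + 4))]"
    unfolding map_map by (subst concat_map_triples) simp_all
  then have "?ys @ map ?f [0..<?n] = instance_code" by (simp add: instance_code_def)
  moreover have "?n * (cost (Bin Plus (Num 6) (Var 6)) + cost (transE k) + 11) + 6 \<le> ?n * max_cost k + 6"
    by (intro add_right_mono mult_le_mono2) (simp add: max_cost_def)
  ultimately show ?thesis by (elim steps_weaken) (simp_all only: fun_upd_upd)
qed

lemma steps_prepare:
  "steps W (prepare k) (\<lambda>_. 0, mem0) prepare_time (\<sigma>0(8 := 6 * (G + 4)), mem1(3 := arr_of instance_code))"
  unfolding prepare_def
  by (rule steps_weaken, rule steps_Seq[OF steps_initialize steps_Seq[OF steps_locate_clauses
      steps_Seq[OF steps_write_header steps_Seq[OF steps_word steps_trans]]]])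
    (simp_all add: prepare_time_def add_mult_distrib del: mult_Suc_right)

end

lemma instance_enc: "match_enc (word M (2 ^ h) left_sat, automaton M (2 ^ (n - h)) right_sat) instance_code"
proof -
  let ?f = "edge M (2 ^ (n - h)) right_sat"
  let ?ts = "map ?f [0..<2 * (G + 4)]"
  have "inj_on ?f {..<2 * (G + 4)}" unfolding G_def by (rule inj_edge)
  then have "distinct ?ts" by (simp add: distinct_map atLeast0LessThan)
  moreover have "set ?ts = trans (automaton M (2 ^ (n - h)) right_sat)"
    by (simp add: automaton_def G_def atLeast0LessThan)
  moreover have "instance_code = [length (word M (2 ^ h) left_sat), length ?ts, G + 2, 4, 0, 1] @
      word M (2 ^ h) left_sat @ concat (map enc_trans ?ts)"
    by (simp add: instance_code_def word_def)
  moreover have "word M (2 ^ h) left_sat \<in> lists {..<4}" by (auto simp: word_def letter_def)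
  ultimately show ?thesis
    unfolding match_enc_def prod.case
    by (intro conjI exI[of _ ?ts] wf_automaton) (simp_all add: automaton_def G_def)
qed

text \<open>Each literal has its variable in exactly one half, so an assignment satisfies a clause
  iff one of its halves does. Bit \<open>v\<close> of \<open>b\<close> is the value of variable
  \<open>v\<close>, bit \<open>v - h\<close> of \<open>a\<close> that of a variable
  \<open>v \<ge> h\<close>.\<close>

lemma satisfiable_iff:
  "satisfiable (n, set (map set css)) \<longleftrightarrow>
     (\<exists>b < 2 ^ h. \<exists>a < 2 ^ (n - h). \<forall>j < M. left_sat b j \<or> right_sat a j)"
proof
  assume "satisfiable (n, set (map set css))"
  then obtain \<alpha> where \<alpha>: "\<And>cs. cs \<in> set css \<Longrightarrow> \<exists>(v, b) \<in> set cs. \<alpha> v = b"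
    by (auto simp: satisfiable_def)
  obtain b :: nat where b: "b < 2 ^ h" "\<forall>v < h. bit b v = \<alpha> v" using ex_bits[of h \<alpha>] by blast
  obtain a :: nat where a: "a < 2 ^ (n - h)" "\<forall>v < n - h. bit a v = \<alpha> (v + h)"
    using ex_bits[of "n - h" "\<lambda>v. \<alpha> (v + h)"] by blast
  have "left_sat b j \<or> right_sat a j" if "j < M" for j
  proof -
    have j: "css ! j \<in> set css" using that by (simp add: M_def)
    then obtain v where v: "(v, \<alpha> v) \<in> set (css ! j)" using \<alpha> by fastforce
    then have "v < n" using j clause_vars by blast
    show ?thesis
    proof (cases "v < h")
      case True
      then have "lit_sat h True b (enc_literal (v, \<alpha> v))" using b by (simp add: lit_sat_literal)
      with v show ?thesis unfolding left_sat_def half_sat_def by blast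
    next
      case False
      then have "lit_sat h False a (enc_literal (v, \<alpha> v))"
        using a \<open>v < n\<close> by (simp add: lit_sat_literal)
      with v show ?thesis unfolding right_sat_def half_sat_def by blast
    qed
  qed
  with a(1) b(1) show "\<exists>b < 2 ^ h. \<exists>a < 2 ^ (n - h). \<forall>j < M. left_sat b j \<or> right_sat a j" by blast
next
  assume "\<exists>b < 2 ^ h. \<exists>a < 2 ^ (n - h). \<forall>j < M. left_sat b j \<or> right_sat a j"
  then obtain a b where ab: "\<And>j. j < M \<Longrightarrow> left_sat b j \<or> right_sat a j" by blast
  define \<alpha> where "\<alpha> v = (if v < h then bit b v else bit a (v - h))" for v
  have "\<exists>(v, s) \<in> set cs. \<alpha> v = s" if "cs \<in> set css" for cs
  proof -
    obtain j where j: "j < M" "css ! j = cs" using \<open>cs \<in> set css\<close> by (auto simp: in_set_conv_nth M_def)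
    from ab[OF j(1)] obtain v s where "(v, s) \<in> set cs"
      "lit_sat h True b (enc_literal (v, s)) \<or> lit_sat h False a (enc_literal (v, s))"
      unfolding left_sat_def right_sat_def half_sat_def j(2) by force
    then show ?thesis by (intro bexI[of _ "(v, s)"]) (auto simp: lit_sat_literal \<alpha>_def)
  qed
  then show "satisfiable (n, set (map set css))" by (auto simp: satisfiable_def)
qed

end

text \<open>Since \<open>w\<close> is both its own longest subsequence and its own shortest supersequence, the length
  of the answer already decides whether the automaton accepts \<open>w\<close>.\<close>

definition decides_membership :: "(match_instance \<Rightarrow> nat list \<Rightarrow> bool) \<Rightarrow> bool" where
  "decides_membership ans \<longleftrightarrow> (\<forall>w A ys. ans (w, A) ys \<longrightarrow> ys \<noteq> [] \<and> (ys ! 0 = 2 \<longrightarrow> 2 \<le> length ys) \<and>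
     (ys ! 0 = 2 \<and> ys ! 1 = length w \<longleftrightarrow> w \<in> lang A))"

lemma decides_max_subseq:
  assumes "out = out_string \<or> out = out_length"
  shows "decides_membership (max_subseq out)"
proof -
  have "ys \<noteq> [] \<and> (ys ! 0 = 2 \<longrightarrow> 2 \<le> length ys) \<and> (ys ! 0 = 2 \<and> ys ! 1 = length w \<longleftrightarrow> w \<in> lang A)"
    if a: "max_answer {u \<in> lang A. subseq u w} a" and ys: "ys = out a" for w A ys a
  proof (cases a)
    case NoString
    then have "{u \<in> lang A. subseq u w} = {}" using a by simp
    then have "w \<notin> lang A" by (metis (mono_tags, lifting) empty_iff mem_Collect_eq subseq_order.order_refl)
    then show ?thesis using ys assms NoString by auto
  next
    case Unbounded
    \<comment> \<open>A subsequence of \<open>w\<close> is no longer than \<open>w\<close>, so this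
      answer is impossible.\<close>
    then have "\<exists>u \<in> {u \<in> lang A. subseq u w}. length w < length u" using a by simp
    then show ?thesis by (metis (mono_tags, lifting) mem_Collect_eq leD list_emb_length)
  next
    case (Found u)
    then have u: "u \<in> lang A" "subseq u w" "w \<in> lang A \<longrightarrow> length w \<le> length u" using a by simp_all
    have "length u = length w \<longleftrightarrow> w \<in> lang A"
      using u list_emb_length[OF u(2)] subseq_same_length[OF u(2)] by fastforce
    then show ?thesis using ys assms unfolding Found by (elim disjE) (simp_all add: One_nat_def)
  qed
  then show ?thesis unfolding decides_membership_def max_subseq_def by blast
qed

lemma decides_min_superseq:
  assumes "out = out_string \<or> out = out_length"
  shows "decides_membership (min_superseq out)"
proof -
  have "ys \<noteq> [] \<and> (ys ! 0 = 2 \<longrightarrow> 2 \<le> length ys) \<and> (ys ! 0 = 2 \<and> ys ! 1 = length w \<longleftrightarrow> w \<in> lang A)"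
    if a: "min_answer {u \<in> lang A. subseq w u} a" and ys: "ys = out a" for w A ys a
  proof (cases a)
    case NoString
    then have "{u \<in> lang A. subseq w u} = {}" using a by simp
    then have "w \<notin> lang A" by (metis (mono_tags, lifting) empty_iff mem_Collect_eq subseq_order.order_refl)
    then show ?thesis using ys assms NoString by auto
  next
    case Unbounded
    then show ?thesis using a by simp
  next
    case (Found u)
    then have u: "u \<in> lang A" "subseq w u" "w \<in> lang A \<longrightarrow> length u \<le> length w" using a by simp_all
    have "length u = length w \<longleftrightarrow> w \<in> lang A"
      using u list_emb_length[OF u(2)] subseq_same_length[OF u(2)] by fastforce
    then show ?thesis using ys assms unfolding Found by (elim disjE) (simp_all add: One_nat_def)
  qed
  then show ?thesis unfolding decides_membership_def min_superseq_def by blast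
qed

text \<open>Equality is tested by a zero xor. Array 4 is the solver's output array 1 after renaming,
  variable 6 the length of the word. Cell 1 is consulted only if cell 0 announces a string.\<close>

definition resultE :: exp where
  "resultE = Ite (Bin Xor (Arr 4 (Num 0)) (Num 2)) (Num 0)
     (Ite (Bin Xor (Arr 4 (Num 1)) (Var 6)) (Num 0) (Num 1))"

definition sat_program :: "nat \<Rightarrow> com \<Rightarrow> com" where
  "sat_program k P = Seq (prepare k)
     (Seq (rename (\<lambda>x. 3 * x + 2) (\<lambda>a. a + 3) P) (Sto 1 (Num 0) resultE))"

context kcnf begin

text \<open>\<open>W\<close> is a sum so that it serves the preparation, the solver and the final
  xors, each of which is at most the sum of its arguments.\<close>

lemma exec_sat_program:
  assumes P: "exec W0 P (init_state instance_code) t s" "outputs s ys"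
    and ys: "ys \<noteq> []" "ys ! 0 = 2 \<longrightarrow> 2 \<le> length ys"
    and W: "W = B ^ max_cost k + W0 + 5"
  shows "\<exists>t' s'. t' \<le> prepare_time + t + 20 \<and>
    exec W (sat_program k P) (init_state (formula_code n css)) t' s' \<and>
    outputs s' [of_bool (ys ! 0 = 2 \<and> ys ! 1 = 2 ^ h * Suc M)]"
proof -
  let ?f = "\<lambda>x. 3 * x + 2 :: nat" and ?g = "\<lambda>a. a + 3 :: nat"
  define m where "m = mem1(3 := arr_of instance_code)"
  have BW: "B ^ max_cost k < W" by (simp add: W)
  have init: "init_state (formula_code n css) = (\<lambda>_. 0, mem0)"
    by (auto simp: init_state_def arr_of_def fun_eq_iff)
  from steps_prepare[OF BW, folded m_def, unfolded steps_def fst_conv snd_conv, rule_format,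
      of "\<lambda>_. 0", OF refl]
  obtain t1 r1 where 1: "t1 \<le> prepare_time" "exec W (prepare k) ((\<lambda>_. 0), mem0) t1 (r1, m)"
    "\<forall>x. r1 (3 * x) = (\<sigma>0(8 := 6 * (G + 4))) x" "\<forall>x. r1 (3 * x + 2) = 0"
    by blast
  \<comment> \<open>The solver sees its own initial state: the registers \<open>3 * x + 2\<close>
    are still zero, array 3 holds the instance, and the arrays above it are still zero.\<close>
  have "pull ?f ?g (r1, m) = init_state instance_code"
    using 1(4) by (auto simp: pull_def init_state_def m_def arr_of_def fun_eq_iff)
  moreover have "inj ?f" "inj ?g" by (auto simp: inj_def)
  ultimately obtain r2 m2 where 2: "exec W0 (rename ?f ?g P) (r1, m) t (r2, m2)"
    "pull ?f ?g (r2, m2) = s" "same_outside ?f ?g (r1, m) (r2, m2)"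
    using exec_rename[OF P(1)] by (metis surj_pair)
  have 2: "exec W (rename ?f ?g P) (r1, m) t (r2, m2)"
    "snd s 1 = m2 4" "\<forall>x. r2 (3 * x) = (\<sigma>0(8 := 6 * (G + 4))) x"
  proof -
    show "exec W (rename ?f ?g P) (r1, m) t (r2, m2)" by (rule exec_mono[OF 2(1)]) (simp add: W)
    show "snd s 1 = m2 4" using 2(2) by (auto simp: pull_def)
    have "3 * x \<notin> range ?f" for x by (auto; presburger)
    then show "\<forall>x. r2 (3 * x) = (\<sigma>0(8 := 6 * (G + 4))) x"
      using 2(3) 1(3) by (simp add: same_outside_def)
  qed
  \<comment> \<open>With \<open>Suc W0\<close> the initial zeros are below the bound even for
    \<open>W0 = 0\<close>.\<close>
  have "exec (Suc W0) P (init_state instance_code) t s" by (rule exec_mono[OF P(1)]) simp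
  then have "\<forall>i. snd s 1 i < Suc W0"
    by (rule exec_bounded[THEN conjunct2]) (auto simp: init_state_def)
  then have small: "m2 4 i \<le> W0" for i unfolding 2(2) by (simp add: less_Suc_eq_le)
  have out: "m2 4 i = ys ! i" if "i < length ys" for i
    using P(2) that 2(2) by (auto simp: outputs_def)
  let ?\<sigma> = "\<sigma>0(8 := 6 * (G + 4))"
  have lw: "?\<sigma> 6 = 2 ^ h * Suc M" by (simp add: \<sigma>0_def)
  have lwB: "2 ^ h * Suc M \<le> B ^ max_cost k" using bounds(9) max_cost_bounds(2) by (rule order_trans)
  have x1: "Bit_Operations.xor (m2 4 0) 2 < W" using xor_le_plus[of "m2 4 0" 2] small[of 0] by (simp add: W)
  have x2: "Bit_Operations.xor (m2 4 1) (2 ^ h * Suc M) < W"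
    using xor_le_plus[of "m2 4 1" "2 ^ h * Suc M"] small[of 1] lwB unfolding W by linarith
  have fits: "fits W resultE ?\<sigma> m2"
    using x1 x2 lwB small[of 0] small[of 1] unfolding resultE_def fits.simps eval.simps lw apply_op.simps
    by (auto simp: W)
  have xor_0: "Bit_Operations.xor x y = 0 \<longleftrightarrow> x = y" for x y :: nat
    by (metis bit.xor_self xor.left_neutral xor.assoc xor.right_neutral xor_self_eq)
  have eval: "eval resultE ?\<sigma> m2 = of_bool (ys ! 0 = 2 \<and> ys ! 1 = 2 ^ h * Suc M)"
    using out[of 0] out[of 1] ys unfolding resultE_def eval.simps lw apply_op.simps xor_0 by auto
  have "fits W (Num 0) ?\<sigma> m2" by (simp add: W)
  from steps_Sto[OF this fits, of 1] obtain t3 r3 m3 where 3: "t3 \<le> 1 + 1 + cost resultE"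
    "exec W (Sto 1 (Num 0) resultE) (r2, m2) t3 (r3, m3)"
    "m3 = m2(1 := (m2 1)(0 := of_bool (ys ! 0 = 2 \<and> ys ! 1 = 2 ^ h * Suc M)))"
    using 2(3) unfolding steps_def eval by auto
  have "exec W (sat_program k P) (init_state (formula_code n css)) (t1 + (t + t3)) (r3, m3)"
    unfolding sat_program_def init by (rule exec_Seq[OF 1(2) exec_Seq[OF 2(1) 3(2)]])
  moreover have "outputs (r3, m3) [of_bool (ys ! 0 = 2 \<and> ys ! 1 = 2 ^ h * Suc M)]"
    by (simp add: outputs_def 3(3))
  ultimately show ?thesis using 1(1) 3(1)
    by (intro exI[of _ "t1 + (t + t3)"] exI[of _ "(r3, m3)"]) (simp add: resultE_def)
qed

end

section \<open>Running time\<close>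

text \<open>An instance of \<open>1 + x \<le> exp x\<close>, at \<open>x = c * n\<close> with
  \<open>c = \<gamma> * ln 2\<close>; the factor makes \<open>(2 / c + 1) * (1 + c * n)\<close>
  contain both \<open>2 * n\<close> and 1.\<close>

lemma linear_le_exp:
  fixes \<gamma> :: real
  assumes "\<gamma> > 0"
  shows "2 * real n + 1 \<le> (2 / (\<gamma> * ln 2) + 1) * 2 powr (\<gamma> * real n)"
proof -
  define c where "c = \<gamma> * ln 2"
  have c: "c > 0" using assms by (simp add: c_def)
  have "2 * real n + 1 \<le> (2 / c + 1) * (1 + c * real n)"
    using c by (simp add: field_simps)
  also have "\<dots> \<le> (2 / c + 1) * exp (c * real n)"
    using c by (intro mult_left_mono exp_ge_add_one_self) auto
  also have "exp (c * real n) = 2 powr (\<gamma> * real n)" by (simp add: powr_def c_def mult_ac)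
  finally show ?thesis by (simp add: c_def)
qed

lemma poly_le_exp:
  fixes \<delta> :: real
  assumes "\<delta> > 0"
  obtains c where "c \<ge> 1" "\<And>n. (real ((2 * n + 1) ^ k + 1)) ^ 2 \<le> c * 2 powr (\<delta> * real n)"
proof -
  \<comment> \<open>Keeps the \<open>2 * k\<close>-th power of \<open>2 powr (\<gamma> * n)\<close>
    below \<open>2 powr (\<delta> * n)\<close>; the added 1 avoids division by zero for
    \<open>k = 0\<close>.\<close>
  define \<gamma> where "\<gamma> = \<delta> / (2 * real k + 1)"
  define c0 where "c0 = 2 / (\<gamma> * ln 2) + 1"
  have \<gamma>: "\<gamma> > 0" "\<gamma> * (2 * real k) \<le> \<delta>" using assms by (simp_all add: \<gamma>_def field_simps)
  have c0: "c0 \<ge> 1" using \<gamma> by (simp add: c0_def)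
  show ?thesis
  proof (rule that)
    show "1 \<le> 4 * c0 ^ (2 * k)" using one_le_power[OF c0, of "2 * k"] by linarith
    fix n
    have "real ((2 * n + 1) ^ k + 1) \<le> 2 * (2 * real n + 1) ^ k"
      using one_le_power[of "2 * real n + 1" k] by simp
    then have "(real ((2 * n + 1) ^ k + 1)) ^ 2 \<le> (2 * (2 * real n + 1) ^ k) ^ 2"
      by (intro power_mono) simp_all
    also have "\<dots> = 4 * (2 * real n + 1) ^ (2 * k)" by (simp add: power_mult_distrib power_mult[symmetric] mult.commute)
    also have "(2 * real n + 1) ^ (2 * k) \<le> (c0 * 2 powr (\<gamma> * real n)) ^ (2 * k)"
      unfolding c0_def by (intro power_mono linear_le_exp \<gamma>) simp
    also have "\<dots> = c0 ^ (2 * k) * 2 powr (\<gamma> * real n * (2 * real k))"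
      by (simp add: power_mult_distrib powr_powr flip: powr_realpow)
    also have "\<dots> \<le> c0 ^ (2 * k) * 2 powr (\<delta> * real n)"
      using c0 \<gamma>(2) mult_right_mono[OF \<gamma>(2), of "real n"]
      by (intro mult_left_mono powr_mono) (simp_all add: mult_ac)
    finally show "(real ((2 * n + 1) ^ k + 1)) ^ 2 \<le> 4 * c0 ^ (2 * k) * 2 powr (\<delta> * real n)"
      by (simp add: mult_ac)
  qed
qed

text \<open>\<open>solvable_in_time\<close> allows only bounds \<open>(K + y) ^ K\<close>, so
  constant factors must move into base and exponent. With \<open>x = a + y\<close> above both
  \<open>A\<close> and \<open>1 + y\<close>, the bases are at most \<open>x ^ 3\<close> and
  \<open>x ^ 2\<close>, and the factor 3 of the three summands costs one more power of
  \<open>x\<close>.\<close>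

lemma word_size_bound:
  fixes A :: real and p q :: nat
  obtains K :: nat where "\<And>y w1 w2. y \<ge> 1 \<Longrightarrow> w1 \<le> (A * y ^ 2) ^ p \<Longrightarrow> w2 \<le> (A + A * y) ^ q \<Longrightarrow> A \<ge> 1 \<Longrightarrow>
    w1 + w2 + 5 \<le> (real K + y) ^ K"
proof (cases "A \<ge> 1")
  case True
  define a where "a = nat \<lceil>A\<rceil> + 5"
  have a: "A \<le> real a" "real a \<ge> 5" unfolding a_def by linarith+
  define N where "N = 3 * p + 2 * q + 1"
  show ?thesis
  proof (rule that)
    fix y w1 w2 :: real
    assume y: "y \<ge> 1" and w1: "w1 \<le> (A * y ^ 2) ^ p" and w2: "w2 \<le> (A + A * y) ^ q"
    define x where "x = real a + y"
    have x: "x \<ge> 5" "A \<le> x" "y \<le> x" "1 + y \<le> x" using a y by (simp_all add: x_def)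
    have mono: "x ^ i \<le> x ^ N" if "i \<le> N" for i using x that by (intro power_increasing) auto
    have "A * y ^ 2 \<le> x * x ^ 2" using x y True by (intro mult_mono power_mono) auto
    then have "(A * y ^ 2) ^ p \<le> (x ^ 3) ^ p"
      using True by (intro power_mono) (simp_all add: power3_eq_cube power2_eq_square mult_ac)
    then have 1: "w1 \<le> x ^ N"
      using w1 mono[of "3 * p"] by (simp add: power_mult[symmetric] N_def)
    have "A + A * y = A * (1 + y)" by (simp add: algebra_simps)
    also have "\<dots> \<le> x * x" using x y True by (intro mult_mono) auto
    finally have "(A + A * y) ^ q \<le> (x ^ 2) ^ q"
      using True y by (intro power_mono) (simp_all add: power2_eq_square)
    then have 2: "w2 \<le> x ^ N"
      using w2 mono[of "2 * q"] by (simp add: power_mult[symmetric] N_def)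
    have 3: "5 \<le> x ^ N" using x mono[of 1] by (simp add: N_def)
    have "w1 + w2 + 5 \<le> 3 * x ^ N" using 1 2 3 by linarith
    also have "\<dots> \<le> x * x ^ N" using x by (intro mult_right_mono) auto
    also have "\<dots> = x ^ Suc N" by simp
    also have "\<dots> \<le> (real (a + N + 1) + y) ^ Suc N"
      using x by (intro power_mono) (simp_all add: x_def)
    also have "\<dots> \<le> (real (a + N + 1) + y) ^ (a + N + 1)"
      using y by (intro power_increasing) auto
    finally show "w1 + w2 + 5 \<le> (real (a + N + 1) + y) ^ (a + N + 1)" .
  qed
qed (use that in auto)

text \<open>Padded with \<open>None\<close>, a clause becomes a list of length exactly
  \<open>k\<close> over \<open>2 * n\<close> literals and one blank. Distinctness of the clauses as
  sets turns this into a bound on the list of clauses.\<close>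

lemma card_clauses:
  fixes css :: "literal list list"
  assumes "distinct (map set css)"
    and "\<And>cs. cs \<in> set css \<Longrightarrow> length cs \<le> k"
    and "\<And>cs v b. cs \<in> set css \<Longrightarrow> (v, b) \<in> set cs \<Longrightarrow> v < n"
  shows "length css \<le> (2 * n + 1) ^ k"
proof -
  let ?L = "insert None (Some ` ({..<n} \<times> (UNIV :: bool set)))"
  let ?lists = "{xs. set xs \<subseteq> ?L \<and> length xs = k}"
  have cL: "card ?L = 2 * n + 1" "finite ?L"
    by (simp_all add: card_image card_cartesian_product card_UNIV_bool)
  have "set (map set css) \<subseteq> (\<lambda>xs. {l. Some l \<in> set xs}) ` ?lists"
  proof
    fix c assume "c \<in> set (map set css)"
    then obtain cs where cs: "cs \<in> set css" "c = set cs" by auto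
    let ?xs = "map Some cs @ replicate (k - length cs) None"
    have "set ?xs \<subseteq> ?L" using assms(3)[OF cs(1)] by (auto split: if_splits)
    then have "?xs \<in> ?lists" using assms(2)[OF cs(1)] by simp
    moreover have "c = {l. Some l \<in> set ?xs}" using cs by auto
    ultimately show "c \<in> (\<lambda>xs. {l. Some l \<in> set xs}) ` ?lists" by blast
  qed
  then have "card (set (map set css)) \<le> card ?lists"
    by (rule surj_card_le[OF finite_lists_length_eq[OF cL(2)]])
  then show ?thesis using cL distinct_card[OF assms(1)] by (simp add: card_lists_length_eq)
qed

context kcnf begin

text \<open>\<open>Q\<close> is \<open>(|w| m) powr (1 - e)\<close> up to a constant, except that
  the clause factor is kept in full. The linear term and the preparation fit below it because
  \<open>e \<le> 1 / 2\<close>.\<close>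

lemma time_bounds:
  fixes e \<epsilon> :: real
  assumes e: "0 < e" "e \<le> \<epsilon>" "e \<le> 1 / 2"
  defines "Q \<equiv> 2 powr ((1 - e) * real n) * real (Suc M) ^ 2"
  shows "match_time \<epsilon> (word M (2 ^ h) left_sat, automaton M (2 ^ (n - h)) right_sat) \<le> 31 * Q"
    and "real prepare_time \<le> (220 + 37 * real (max_cost k)) * Q"
    and "real B \<le> (33 + 2 * real k) * Q ^ 2"
    and "1 \<le> Q"
proof -
  define Z D where "Z = 2 powr ((1 - e) * real n)" and "D = real (Suc M)"
  have D: "D \<ge> 1" by (simp add: D_def)
  have Z: "Z \<ge> 1" using e by (simp add: Z_def ge_one_powr_ge_zero)
  have ZD: "1 \<le> Z * D" "D \<le> Z * D" "Z * D \<le> Q" "D \<le> Q"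
  proof -
    show "1 \<le> Z * D" using mult_mono[OF Z D] Z by simp
    show "D \<le> Z * D" using mult_right_mono[OF Z, of D] D by simp
    have "Z * D * 1 \<le> Z * D * D" using Z D by (intro mult_left_mono) auto
    then show "Z * D \<le> Q" by (simp add: Q_def Z_def D_def power2_eq_square mult_ac)
    with \<open>D \<le> Z * D\<close> show "D \<le> Q" by linarith
  qed
  show Q1: "1 \<le> Q" using ZD by linarith
  have half: "2 powr (real n / 2) \<le> Z" unfolding Z_def
    using e mult_right_mono[of "1 / 2" "1 - e" "real n"] by (intro powr_mono) auto
  have h: "real (2 ^ h) \<le> Z"
  proof -
    have "real (2 ^ h) = 2 powr real h" by (simp add: powr_realpow)
    also have "\<dots> \<le> 2 powr (real n / 2)" by (intro powr_mono) (auto simp: h_def)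
    finally show ?thesis using half by linarith
  qed
  \<comment> \<open>The second half may have one variable more than the first, hence the factor
    2.\<close>
  have nh: "real (2 ^ (n - h)) \<le> 2 * Z"
  proof -
    have "real (2 ^ (n - h)) = 2 powr real (n - h)" by (simp add: powr_realpow)
    also have "\<dots> \<le> 2 powr (1 + real n / 2)" by (intro powr_mono) (auto simp: h_def)
    also have "\<dots> = 2 * 2 powr (real n / 2)" by (simp add: powr_add)
    finally show ?thesis using half by linarith
  qed
  have lw: "real (2 ^ h * Suc M) \<le> Z * D"
    unfolding of_nat_mult D_def[symmetric] using h D by (intro mult_right_mono) auto
  have G: "real G \<le> 2 * (Z * D)"
    unfolding G_def of_nat_mult D_def[symmetric] using mult_right_mono[OF nh, of D] D by simp
  have nat1: "1 \<le> 2 ^ h * Suc M" "1 \<le> G"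
    by (simp_all add: G_def One_nat_def Suc_le_eq del: mult_Suc_right)

  let ?A = "automaton M (2 ^ (n - h)) right_sat" and ?w = "word M (2 ^ h) left_sat"
  have "inj_on (edge M (2 ^ (n - h)) right_sat) {..<2 * (G + 4)}" unfolding G_def by (rule inj_edge)
  from card_image[OF this] have "card (trans ?A) = 2 * (G + 4)"
    unfolding automaton_def enfa.simps G_def[symmetric] by simp
  then have size: "length ?w = 2 ^ h * Suc M" "card (trans ?A) = 2 * (G + 4)" "card (states ?A) = G + 2"
    "card (alphabet ?A) = 4"
    by (simp_all add: word_def automaton_def G_def)
  have "real (input_size (?w, ?A)) = real (2 ^ h * Suc M) + 3 * real G + 14"
    unfolding input_size_def prod.case size by simp
  also have "\<dots> \<le> 21 * (Z * D)" using lw G ZD by linarith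
  also have "\<dots> \<le> 21 * Q" using ZD by simp
  finally have 1: "real (input_size (?w, ?A)) \<le> 21 * Q" .
  define p where "p = real (2 ^ h * Suc M) * real (2 * (G + 4))"
  have p1: "1 \<le> p"
  proof -
    have "1 * 1 \<le> (2 ^ h * Suc M) * (2 * (G + 4))" using nat1 by (intro mult_le_mono) simp_all
    then show ?thesis unfolding p_def of_nat_mult[symmetric] by linarith
  qed
  \<comment> \<open>From \<open>G \<ge> 1\<close>, so that \<open>G + 4 \<le> 5 * G\<close>.\<close>
  have "p \<le> real (2 ^ h * Suc M) * real (10 * G)"
    unfolding p_def using nat1(2) by (intro mult_left_mono) simp_all
  also have "\<dots> = 10 * (real (2 ^ h * 2 ^ (n - h)) * D ^ 2)"
    by (simp only: G_def D_def power2_eq_square of_nat_mult of_nat_numeral mult_ac)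
  also have "\<dots> = 10 * (2 powr real n * D ^ 2)"
    unfolding half_powers(1) by (simp add: powr_realpow)
  finally have p: "p \<le> 10 * (2 powr real n * D ^ 2)" .
  \<comment> \<open>As \<open>p \<ge> 1\<close>, passing to the smaller saving \<open>e\<close> only
    enlarges the power.\<close>
  have "p powr (1 - \<epsilon>) \<le> p powr (1 - e)" using p1 e by (intro powr_mono) auto
  also have "\<dots> \<le> (10 * (2 powr real n * D ^ 2)) powr (1 - e)"
    using p p1 e by (intro powr_mono2) auto
  also have "\<dots> = 10 powr (1 - e) * (Z * (D ^ 2) powr (1 - e))"
    by (simp add: powr_mult powr_powr Z_def mult_ac)
  also have "\<dots> \<le> 10 * (Z * D ^ 2)"
  proof (intro mult_mono)
    show "10 powr (1 - e) \<le> 10" using powr_mono[of "1 - e" 1 10] e by simp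
    have "1 \<le> D ^ 2" using D by (simp add: one_le_power)
    then show "(D ^ 2) powr (1 - e) \<le> D ^ 2" using powr_mono[of "1 - e" 1 "D ^ 2"] e by simp
  qed (use Z in auto)
  also have "Z * D ^ 2 = Q" by (simp add: Q_def Z_def D_def)
  finally have 2: "p powr (1 - \<epsilon>) \<le> 10 * Q" by simp
  show "match_time \<epsilon> (?w, ?A) \<le> 31 * Q"
    using 1 2 unfolding match_time_def prod.case size p_def by simp

  have "real prepare_time =
      200 + 20 * real M + (real (2 ^ h * Suc M) + 6 * (real G + 4)) * real (max_cost k)"
    unfolding prepare_time_def by simp
  also have "\<dots> \<le> 200 * Q + 20 * Q + (37 * Q) * real (max_cost k)"
  proof (intro add_mono mult_right_mono)
    show "20 * real M \<le> 20 * Q" using ZD by (simp add: D_def)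
    have "real G \<le> 2 * Q" using G ZD by linarith
    then have "6 * (real G + 4) \<le> 36 * Q" using Q1 by (simp add: algebra_simps)
    moreover have "real (2 ^ h * Suc M) \<le> Q" using lw ZD(3) by (rule order_trans)
    ultimately show "real (2 ^ h * Suc M) + 6 * (real G + 4) \<le> 37 * Q" by linarith
  qed (use Q1 in auto)
  also have "\<dots> = (220 + 37 * real (max_cost k)) * Q" by (simp add: algebra_simps)
  finally show "real prepare_time \<le> (220 + 37 * real (max_cost k)) * Q" .

  have len: "length (formula_code n css) \<le> 2 + M * (k + 1)"
  proof -
    have "length (concat (map clause_code css)) = (\<Sum>cs\<leftarrow>css. length cs + 1)"
      by (simp add: length_concat comp_def clause_code_def One_nat_def)
    also have "\<dots> \<le> (\<Sum>cs\<leftarrow>css. k + 1)" using clause_length by (intro sum_list_mono) simp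
    also have "\<dots> = M * (k + 1)" by (simp add: sum_list_triv M_def)
    finally show ?thesis by (simp add: formula_code_def)
  qed
  define X where "X = 2 ^ n * Suc M"
  have X: "Suc M \<le> X" unfolding X_def using mult_le_mono1[of 1 "2 ^ n" "Suc M"] by simp
  have "B = 6 * (X + 4) + length (formula_code n css) + k" by (simp only: B_def X_def)
  also have "\<dots> \<le> 6 * X + 24 + (2 + X * (k + 1)) + k"
  proof -
    have "M * (k + 1) \<le> X * (k + 1)" using X by (intro mult_le_mono1) simp
    then have "length (formula_code n css) \<le> 2 + X * (k + 1)" using len by (meson add_left_mono order_trans)
    then show ?thesis by simp
  qed
  also have "\<dots> \<le> (33 + 2 * k) * X"
  proof -
    have "k * 1 + 26 * 1 \<le> k * X + 26 * X" using X by (intro add_mono mult_le_mono2) simp_all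
    then show ?thesis by (simp add: algebra_simps)
  qed
  finally have "real B \<le> real ((33 + 2 * k) * X)" by linarith
  also have "\<dots> = (33 + 2 * real k) * real X" by simp
  \<comment> \<open>\<open>Z\<close> dominates \<open>2 powr (n / 2)\<close>, so
    \<open>2 ^ n\<close> is at most \<open>Z * Z\<close>; this is why a square of \<open>Q\<close>
    suffices.\<close>
  also have "\<dots> \<le> (33 + 2 * real k) * Q ^ 2"
  proof (intro mult_left_mono)
    have "real X = real (2 ^ h) * real (2 ^ (n - h)) * D"
      unfolding X_def D_def of_nat_mult half_powers(1)[symmetric] by simp
    also have "real (2 ^ h) * real (2 ^ (n - h)) = 2 powr real n"
      unfolding of_nat_mult[symmetric] half_powers(1) by (simp add: powr_realpow)
    also have "\<dots> = 2 powr (real n / 2) * 2 powr (real n / 2)" by (simp flip: powr_add)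
    also have "\<dots> * D \<le> (Z * Z) * (D * D)" using half D Z by (intro mult_mono) auto
    also have "\<dots> = (Z * D) ^ 2" by (simp add: power2_eq_square mult_ac)
    also have "\<dots> \<le> Q ^ 2" using ZD by (intro power_mono) auto
    finally show "real X \<le> Q ^ 2" .
  qed simp
  finally show "real B \<le> (33 + 2 * real k) * Q ^ 2" .
qed

end

lemma ksat_solvable:
  fixes \<epsilon> :: real
  assumes \<epsilon>: "\<epsilon> > 0" and ans: "decides_membership ans"
    and solv: "solvable_in_time match_enc ans (match_time \<epsilon>)"
  defines "e \<equiv> min \<epsilon> (1 / 2)"
  shows "solvable_in_time (ksat_enc k) sat_answer (\<lambda>(n, F). 2 powr ((1 - e / 2) * real n))"
proof -
  obtain P C K where P: "\<And>x xs. match_enc x xs \<Longrightarrow> \<exists>W t s ys. real W \<le> (real K + match_time \<epsilon> x) ^ K \<and>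
      real t \<le> C * match_time \<epsilon> x \<and> exec W P (init_state xs) t s \<and> outputs s ys \<and> ans x ys"
    using solv unfolding solvable_in_time_def by blast
  have e: "0 < e" "e \<le> \<epsilon>" "e \<le> 1 / 2" using \<epsilon> by (auto simp: e_def)
  obtain c where c: "c \<ge> 1" "\<And>n. (real ((2 * n + 1) ^ k + 1)) ^ 2 \<le> c * 2 powr (e / 2 * real n)"
    using poly_le_exp[of "e / 2" k] e by auto
  \<comment> \<open>A negative \<open>C\<close> would break monotonicity when the time is replaced
    by a larger bound.\<close>
  define C0 where "C0 = max C 0"
  \<comment> \<open>Dominates the constants of both word sizes: that of \<open>B\<close> in terms of
    \<open>Y ^ 2\<close>, and \<open>K\<close> and the factor of \<open>match_time\<close> for the
    solver.\<close>
  define A where "A = max ((33 + 2 * real k) * c ^ 2) (max (real K) (31 * c))"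
  have A: "(33 + 2 * real k) * c ^ 2 \<le> A" "real K \<le> A" "31 * c \<le> A" "1 \<le> A"
    using c(1) by (auto simp: A_def)
  obtain K' :: nat where K': "\<And>y w1 w2. y \<ge> 1 \<Longrightarrow> w1 \<le> (A * y ^ 2) ^ max_cost k \<Longrightarrow>
      w2 \<le> (A + A * y) ^ K \<Longrightarrow> A \<ge> 1 \<Longrightarrow> w1 + w2 + 5 \<le> (real K' + y) ^ K'"
    using word_size_bound[of A "max_cost k" K] by metis
  define C' where "C' = (220 + 37 * real (max_cost k) + 31 * C0 + 20) * c"
  show ?thesis
    unfolding solvable_in_time_def
  proof (rule exI[of _ "sat_program k P"], rule exI[of _ C'], rule exI[of _ K'], intro allI impI)
    fix \<phi> xs assume enc: "ksat_enc k \<phi> xs"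
    obtain n F where \<phi>: "\<phi> = (n, F)" by (cases \<phi>)
    from enc obtain css where is_k: "is_kcnf k (n, F)" and F: "F = set (map set css)"
      and dist: "distinct (map set css)" "\<forall>cs \<in> set css. distinct cs"
      and xs: "xs = formula_code n css"
      unfolding \<phi> ksat_enc_def formula_code_def clause_code_def by auto
    have len: "length cs \<le> k" if "cs \<in> set css" for cs
      using is_k dist(2) that by (auto simp: is_kcnf_def F distinct_card[symmetric])
    have vars: "v < n" if "cs \<in> set css" "(v, b) \<in> set cs" for cs v b
      using is_k that by (force simp: is_kcnf_def F)
    interpret kcnf k n css by standard (fact len vars)+
    let ?w = "word M (2 ^ h) left_sat" and ?A = "automaton M (2 ^ (n - h)) right_sat"
    define Y where "Y = 2 powr ((1 - e / 2) * real n)"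
    define Q where "Q = 2 powr ((1 - e) * real n) * real (Suc M) ^ 2"
    note tb = time_bounds[OF e, folded Q_def]
    have Y1: "Y \<ge> 1" using e by (simp add: Y_def ge_one_powr_ge_zero)
    have QY: "Q \<le> c * Y"
    proof -
      have "real (Suc M) ^ 2 \<le> (real ((2 * n + 1) ^ k + 1)) ^ 2"
      proof (intro power_mono)
        have "M \<le> (2 * n + 1) ^ k"
          unfolding M_def by (rule card_clauses[OF dist(1)]) (fact len, fact vars)
        then show "real (Suc M) \<le> real ((2 * n + 1) ^ k + 1)" by linarith
      qed simp
      also have "\<dots> \<le> c * 2 powr (e / 2 * real n)" by (rule c(2))
      finally have "Q \<le> 2 powr ((1 - e) * real n) * (c * 2 powr (e / 2 * real n))"
        unfolding Q_def by (intro mult_left_mono) simp_all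
      also have "\<dots> = c * 2 powr ((1 - e) * real n + e / 2 * real n)" by (simp add: powr_add)
      also have "(1 - e) * real n + e / 2 * real n = (1 - e / 2) * real n" by (simp add: algebra_simps)
      finally show ?thesis by (simp add: Y_def)
    qed
    obtain W0 t s ys where W0: "real W0 \<le> (real K + match_time \<epsilon> (?w, ?A)) ^ K"
      and t: "real t \<le> C * match_time \<epsilon> (?w, ?A)"
      and ex: "exec W0 P (init_state instance_code) t s" "outputs s ys" and a: "ans (?w, ?A) ys"
      using P[OF instance_enc] by blast
    have ys: "ys \<noteq> []" "ys ! 0 = 2 \<longrightarrow> 2 \<le> length ys"
      and iff: "ys ! 0 = 2 \<and> ys ! 1 = 2 ^ h * Suc M \<longleftrightarrow> ?w \<in> lang ?A"
      using ans a unfolding decides_membership_def by (blast, blast, fastforce simp: word_def)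
    define W where "W = B ^ max_cost k + W0 + 5"
    from exec_sat_program[OF ex ys W_def] obtain t' s' where t': "t' \<le> prepare_time + t + 20"
      and ex': "exec W (sat_program k P) (init_state xs) t' s'"
      and out: "outputs s' [of_bool (ys ! 0 = 2 \<and> ys ! 1 = 2 ^ h * Suc M)]"
      unfolding xs by blast
    have "ys ! 0 = 2 \<and> ys ! 1 = 2 ^ h * Suc M \<longleftrightarrow> satisfiable \<phi>"
      unfolding iff word_in_lang_iff \<phi> F satisfiable_iff ..
    with out have out': "outputs s' [of_bool (satisfiable \<phi>)]" by simp
    have mt0: "0 \<le> match_time \<epsilon> (?w, ?A)" by (simp add: match_time_def)
    have "C * match_time \<epsilon> (?w, ?A) \<le> C0 * (31 * Q)"
      using mt0 tb(1) by (intro mult_mono) (auto simp: C0_def)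
    with t have "real t \<le> 31 * C0 * Q" by simp
    then have "real t' \<le> (220 + 37 * real (max_cost k)) * Q + 31 * C0 * Q + 20 * Q"
      using t' tb(2,4) by linarith
    also have "\<dots> = (220 + 37 * real (max_cost k) + 31 * C0 + 20) * Q" by (simp add: algebra_simps)
    also have "\<dots> \<le> (220 + 37 * real (max_cost k) + 31 * C0 + 20) * (c * Y)"
      using QY by (intro mult_left_mono) (auto simp: C0_def)
    finally have time: "real t' \<le> C' * Y" by (simp add: C'_def mult_ac)
    have "real (B ^ max_cost k) \<le> (A * Y ^ 2) ^ max_cost k"
    proof -
      have "real B \<le> (33 + 2 * real k) * (c * Y) ^ 2"
        using tb(3,4) QY by (elim order_trans) (intro mult_left_mono power_mono, auto)
      also have "\<dots> = (33 + 2 * real k) * c ^ 2 * Y ^ 2" by (simp add: power_mult_distrib)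
      also have "\<dots> \<le> A * Y ^ 2" using A by (intro mult_right_mono) auto
      finally show ?thesis unfolding of_nat_power by (intro power_mono) auto
    qed
    moreover have "real W0 \<le> (A + A * Y) ^ K"
    proof -
      have "match_time \<epsilon> (?w, ?A) \<le> 31 * c * Y" using tb(1) QY by linarith
      also have "\<dots> \<le> A * Y" using A Y1 by (intro mult_right_mono) auto
      finally show ?thesis
        using A(2) mt0 by (intro order_trans[OF W0] power_mono add_mono) auto
    qed
    ultimately have "real W \<le> (real K' + Y) ^ K'" unfolding W_def using K'[OF Y1 _ _ A(4)] by simp
    with time ex' out' show "\<exists>W t s ys. real W \<le> (real K' + (case \<phi> of (n, F) \<Rightarrow> 2 powr ((1 - e / 2) * real n))) ^ K' \<and>
        real t \<le> C' * (case \<phi> of (n, F) \<Rightarrow> 2 powr ((1 - e / 2) * real n)) \<and>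
        exec W (sat_program k P) (init_state xs) t s \<and> outputs s ys \<and> sat_answer \<phi> ys"
      unfolding \<phi> prod.case Y_def[symmetric] sat_answer_def by blast
  qed
qed

theorem theorem7p3:
  fixes \<epsilon> :: real
  assumes "\<epsilon> > 0"
    and "solvable_in_time match_enc (max_subseq out_string) (match_time \<epsilon>) \<or>
         solvable_in_time match_enc (min_superseq out_string) (match_time \<epsilon>) \<or>
         solvable_in_time match_enc (max_subseq out_length) (match_time \<epsilon>) \<or>
         solvable_in_time match_enc (min_superseq out_length) (match_time \<epsilon>)"
  shows "\<not> SETH"
proof -
  obtain ans where "decides_membership ans" "solvable_in_time match_enc ans (match_time \<epsilon>)"
    using assms(2) decides_max_subseq decides_min_superseq by blast
  note solvable = ksat_solvable[OF assms(1) this]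
  \<comment> \<open>This saving does not depend on \<open>k\<close>, so it contradicts whichever
    \<open>k\<close> SETH supplies for it.\<close>
  have "min \<epsilon> (1 / 2) / 2 > 0" using assms(1) by simp
  then show ?thesis unfolding SETH_def using solvable by blast
qed

end
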